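(* Consider the finite-horizon, partially observed stochastic control problem described in the context: minimize $J_\gamma=\mathbb{E}\big\{\sum_{k=1}^L \operatorname{tr}(\mathbf{\Sigma}_{k|k}(\mathbf{y}_k,\mathbf{u}_{k-1}))\big\}$ over admissible policies $\gamma=\{\eta_0,\dots,\eta_{L-1}\}$, $\mathbf{u}_k=\eta_k(\mathcal{F}_k)$. Let $J_k(\mathcal{F}_{k-1})$, $1\le k\le L$, be its cost-to-go functions. Then for $k=L-1,\dots,1$, $$J_k(\mathcal{F}_{k-1})=\min_{\mathbf{u}_{k-1}\in\mathcal{U}}\Big[\mathbb{E}_{\mathbf{y}_k}\big\{\operatorname{tr}\big(\mathbf{\Sigma}_{k|k}(\mathbf{y}_k,\mathbf{u}_{k-1})\big)+J_{k+1}(\mathcal{F}_{k-1},\mathbf{y}_k,\mathbf{u}_{k-1})\,\big|\,\mathcal{F}_{k-1},\mathbf{u}_{k-1}\big\}\Big],$$ and for $k=L$, $$J_L(\mathcal{F}_{L-1})=\min_{\mathbf{u}_{L-1}\in\mathcal{U}}\Big[\mathbb{E}_{\mathbf{y}_L}\big\{\operatorname{tr}\big(\mathbf{\Sigma}_{L|L}(\mathbf{y}_L,\mathbf{u}_{L-1})\big)\,\big|\,\mathcal{F}_{L-1},\mathbf{u}_{L-1}\big\}\Big].$$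
   Context: Model. $\mathbf{e}_1,\dots,\mathbf{e}_n$ are the standard unit vectors of $\mathbb{R}^n$. The state $(\mathbf{x}_k)_{k\ge0}$ is a Markov chain on $\{\mathbf{e}_1,\dots,\mathbf{e}_n\}$ with initial distribution $\pi$ and transition matrix $\mathbf{P}$ whose $(j,i)$ entry is $P(\mathbf{x}_{k+1}=\mathbf{e}_j|\mathbf{x}_k=\mathbf{e}_i)$ (columns sum to $1$); the transition is unaffected by past observations and controls. Controls take values in a finite set $\mathcal{U}$. Given the states up to time $k$ and the past observations and controls, the observation $\mathbf{y}_k$ has density $f(\cdot|\mathbf{x}_k,\mathbf{u}_{k-1})$, where $f(\cdot|\mathbf{e}_i,\mathbf{u})$ is the density of $\mathcal{N}(\mathbf{m}_i^{\mathbf{u}},\mathbf{Q}_i^{\mathbf{u}})$ with $\mathbf{Q}_i^{\mathbf{u}}$ positive definite (dimension depending only on $\mathbf{u}$). At $k=0$, $\mathbf{u}_{-1}\in\mathcal{U}$ is a fixed deterministic control. Put $\mathcal{M}(\mathbf{u})=[\mathbf{m}_1^{\mathbf{u}},\dots,\mathbf{m}_n^{\mathbf{u}}]$. Information. $\mathcal{F}_k$ is identified with the information vector $(\mathbf{y}_0,\dots,\mathbf{y}_k,\mathbf{u}_0,\dots,\mathbf{u}_{k-1})$, $\mathcal{F}_0=(\mathbf{y}_0)$, so $\mathcal{F}_k=(\mathcal{F}_{k-1},\mathbf{y}_k,\mathbf{u}_{k-1})$. An admissible policy chooses $\mathbf{u}_k=\eta_k(\mathcal{F}_k)\in\mathcal{U}$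 with $\eta_k$ measurable. $\mathbb{E}_{\mathbf{y}_k}\{\cdot|\mathcal{F}_{k-1},\mathbf{u}_{k-1}\}$ is the expectation over $\mathbf{y}_k$ with density $\sum_i p^i_{k|k-1}f(\mathbf{y}|\mathbf{e}_i,\mathbf{u}_{k-1})$, where $\mathbf{p}_{k|k-1}=(p^i_{k|k-1})_i$ is the conditional distribution of $\mathbf{x}_k$ given $\mathcal{F}_{k-1}$, i.e. $\mathbf{p}_{0|-1}=\pi$ and $$\mathbf{p}_{k+1|k}=\frac{\mathbf{P}\,\mathbf{r}(\mathbf{y}_k,\mathbf{u}_{k-1})\,\mathbf{p}_{k|k-1}}{\mathbf{1}_n^T\mathbf{r}(\mathbf{y}_k,\mathbf{u}_{k-1})\,\mathbf{p}_{k|k-1}},\qquad \mathbf{r}(\mathbf{y},\mathbf{u})=\operatorname{diag}(f(\mathbf{y}|\mathbf{e}_1,\mathbf{u}),\dots,f(\mathbf{y}|\mathbf{e}_n,\mathbf{u})),$$ with $\mathbf{1}_n$ the all-ones column vector. Stage cost. $\mathbf{\Sigma}_{k|k}(\mathbf{y}_k,\mathbf{u}_{k-1})=\operatorname{diag}(\mathbf{p}_{k|k})-\mathbf{p}_{k|k}\mathbf{p}_{k|k}^T$ is the conditional filtering error covariance of the Kalman-like filter $\mathbf{p}_{k|k}=\mathbf{p}_{k|k-1}+\mathbf{G}_k(\mathbf{y}_k-\mathbf{y}_{k|k-1})$, where $\mathbf{y}_{k|k-1}=\mathcal{M}(\mathbf{u}_{k-1})\mathbf{p}_{k|k-1}$,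 $\mathbf{\Sigma}_{k|k-1}=\operatorname{diag}(\mathbf{p}_{k|k-1})-\mathbf{p}_{k|k-1}\mathbf{p}_{k|k-1}^T$, $\widetilde{\mathbf{Q}}_k=\sum_i p^i_{k|k-1}\mathbf{Q}_i^{\mathbf{u}_{k-1}}$ and $\mathbf{G}_k=\mathbf{\Sigma}_{k|k-1}\mathcal{M}^T(\mathbf{u}_{k-1})(\mathcal{M}(\mathbf{u}_{k-1})\mathbf{\Sigma}_{k|k-1}\mathcal{M}^T(\mathbf{u}_{k-1})+\widetilde{\mathbf{Q}}_k)^{-1}$ (the dependence on $\mathcal{F}_{k-1}$ through $\mathbf{p}_{k|k-1}$ is suppressed in the notation). Cost-to-go. For $1\le k\le L$, $J_k(\mathcal{F}_{k-1})$ is the minimum, over the remaining decision rules $\eta_{k-1},\dots,\eta_{L-1}$, of the conditional expected remaining cost $\mathbb{E}\big\{\sum_{t=k}^L\operatorname{tr}(\mathbf{\Sigma}_{t|t}(\mathbf{y}_t,\mathbf{u}_{t-1}))\,\big|\,\mathcal{F}_{k-1}\big\}$. *)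

theory Defs
  imports
    "HOL-Probability.Probability"
    "Jordan_Normal_Form.Determinant"
    "Jordan_Normal_Form.Gauss_Jordan_Elimination"
begin

unbundle no vec_syntax
unbundle no inner_syntax
hide_const (open) Finite_Cartesian_Product.vec Finite_Cartesian_Product.mat
  Finite_Cartesian_Product.row Finite_Cartesian_Product.column
  Determinants.det

section \<open>Matrices and Gaussian densities\<close>

definition trace :: "real mat \<Rightarrow> real" where
  "trace A = (\<Sum>i<dim_row A. A $$ (i, i))"

definition mat_inv :: "real mat \<Rightarrow> real mat" where
  "mat_inv A = the (mat_inverse A)"

definition diag_vec :: "real vec \<Rightarrow> real mat" where
  "diag_vec v = mat_diag (dim_vec v) (($) v)"

definition outer_prod :: "real vec \<Rightarrow> real vec \<Rightarrow> real mat" where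
  "outer_prod v w = mat (dim_vec v) (dim_vec w) (\<lambda>(i, j). v $ i * w $ j)"

definition pos_def :: "nat \<Rightarrow> real mat \<Rightarrow> bool" where
  "pos_def d A \<longleftrightarrow> A \<in> carrier_mat d d \<and> transpose_mat A = A \<and>
     (\<forall>v\<in>carrier_vec d. v \<noteq> 0\<^sub>v d \<longrightarrow> 0 < v \<bullet> (A *\<^sub>v v))"

definition mvn_density :: "real vec \<Rightarrow> real mat \<Rightarrow> real vec \<Rightarrow> real" where
  "mvn_density m Q y =
     exp (- ((y - m) \<bullet> (mat_inv Q *\<^sub>v (y - m))) / 2) / sqrt ((2 * pi) ^ dim_vec m * det Q)"

section \<open>The controlled hidden Markov model\<close>

text \<open>
  The state \<open>e\<^sub>i\<close> is represented by its index \<open>i < nst\<close> (counting from 0). \<open>trans_mat $$ (j, i)\<close> is the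
  probability of moving from \<open>i\<close> to \<open>j\<close>, so columns sum to one. Under control \<open>u\<close> and in state \<open>i\<close>
  the observation is Gaussian on \<open>\<real>\<^sup>d\<close>, \<open>d = odim u\<close>, with mean \<open>omean u i\<close> and covariance
  \<open>ocov u i\<close>. \<open>ctrl0\<close> is the fixed control \<open>u\<^sub>-\<^sub>1\<close>.
\<close>

record 'u hmm =
  nst :: nat
  init_dist :: "real vec"
  trans_mat :: "real mat"
  ctrls :: "'u set"
  ctrl0 :: 'u
  odim :: "'u \<Rightarrow> nat"
  omean :: "'u \<Rightarrow> nat \<Rightarrow> real vec"
  ocov :: "'u \<Rightarrow> nat \<Rightarrow> real mat"

definition valid_hmm :: "'u hmm \<Rightarrow> bool" where
  "valid_hmm M \<longleftrightarrow>
     init_dist M \<in> carrier_vec (nst M) \<and>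
     (\<forall>i<nst M. 0 \<le> init_dist M $ i) \<and> (\<Sum>i<nst M. init_dist M $ i) = 1 \<and>
     trans_mat M \<in> carrier_mat (nst M) (nst M) \<and>
     (\<forall>i<nst M. \<forall>j<nst M. 0 \<le> trans_mat M $$ (j, i)) \<and>
     (\<forall>i<nst M. (\<Sum>j<nst M. trans_mat M $$ (j, i)) = 1) \<and>
     finite (ctrls M) \<and> ctrl0 M \<in> ctrls M \<and>
     (\<forall>u\<in>ctrls M. 0 < odim M u \<and>
        (\<forall>i<nst M. omean M u i \<in> carrier_vec (odim M u) \<and> pos_def (odim M u) (ocov M u i)))"

text \<open>
  An observation under control \<open>u\<close> is an extensional function on \<open>{..<odim u}\<close>, so that
  observations of different dimensions live in one type.
\<close>

definition obs_space :: "'u hmm \<Rightarrow> 'u \<Rightarrow> (nat \<Rightarrow> real) measure" where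
  "obs_space M u = (\<Pi>\<^sub>M i\<in>{..<odim M u}. lborel)"

definition obs_vec :: "'u hmm \<Rightarrow> 'u \<Rightarrow> (nat \<Rightarrow> real) \<Rightarrow> real vec" where
  "obs_vec M u y = vec (odim M u) y"

definition obs_dens :: "'u hmm \<Rightarrow> 'u \<Rightarrow> nat \<Rightarrow> (nat \<Rightarrow> real) \<Rightarrow> real" where
  "obs_dens M u i y = mvn_density (omean M u i) (ocov M u i) (obs_vec M u y)"

section \<open>Information vectors and decision rules\<close>

text \<open>
  The pair \<open>(ys, us)\<close> with \<open>ys\<close> on \<open>{..k}\<close> and \<open>us\<close> on \<open>{..<k}\<close> is the information vector
  \<open>F\<^sub>k = (y\<^sub>0, \<dots>, y\<^sub>k, u\<^sub>0, \<dots>, u\<^sub>k\<^sub>-\<^sub>1)\<close>; \<open>prev_ctrl M us k\<close> is \<open>u\<^sub>k\<^sub>-\<^sub>1\<close>.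
\<close>

type_synonym 'u info = "(nat \<Rightarrow> nat \<Rightarrow> real) \<times> (nat \<Rightarrow> 'u)"

definition prev_ctrl :: "'u hmm \<Rightarrow> (nat \<Rightarrow> 'u) \<Rightarrow> nat \<Rightarrow> 'u" where
  "prev_ctrl M us k = (if k = 0 then ctrl0 M else us (k - 1))"

definition obs_hist :: "'u hmm \<Rightarrow> nat \<Rightarrow> (nat \<Rightarrow> 'u) \<Rightarrow> (nat \<Rightarrow> nat \<Rightarrow> real) measure" where
  "obs_hist M k us = (\<Pi>\<^sub>M t\<in>{..k}. obs_space M (prev_ctrl M us t))"

definition info_vecs :: "'u hmm \<Rightarrow> nat \<Rightarrow> 'u info set" where
  "info_vecs M k =
     {(ys, us). us \<in> {..<k} \<rightarrow>\<^sub>E ctrls M \<and> ys \<in> space (obs_hist M k us)}"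

definition info_snoc :: "nat \<Rightarrow> 'u info \<Rightarrow> (nat \<Rightarrow> real) \<Rightarrow> 'u \<Rightarrow> 'u info" where
  "info_snoc k h y u = ((fst h)(k := y), (snd h)(k - 1 := u))"

definition info_restrict :: "nat \<Rightarrow> 'u info \<Rightarrow> 'u info" where
  "info_restrict k h = (restrict (fst h) {..k}, restrict (snd h) {..<k})"

text \<open>
  Since there are finitely many control histories, measurability in \<open>F\<^sub>k\<close> means measurability in
  the observations for each of them.
\<close>

definition decision_rule :: "'u hmm \<Rightarrow> nat \<Rightarrow> ('u info \<Rightarrow> 'u) \<Rightarrow> bool" where
  "decision_rule M k r \<longleftrightarrow>
     (\<forall>us \<in> {..<k} \<rightarrow>\<^sub>E ctrls M.
        (\<lambda>ys. r (ys, us)) \<in> measurable (obs_hist M k us) (count_space (ctrls M)))"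

definition decision_rules :: "'u hmm \<Rightarrow> nat set \<Rightarrow> (nat \<Rightarrow> 'u info \<Rightarrow> 'u) \<Rightarrow> bool" where
  "decision_rules M T \<eta> \<longleftrightarrow> (\<forall>k\<in>T. decision_rule M k (\<eta> k))"

section \<open>Predictor, Kalman-like filter and stage cost\<close>

definition likelihood_mat :: "'u hmm \<Rightarrow> 'u \<Rightarrow> (nat \<Rightarrow> real) \<Rightarrow> real mat" where
  "likelihood_mat M u y = mat_diag (nst M) (\<lambda>i. obs_dens M u i y)"

text \<open>\<open>predictor M h k\<close> is \<open>p\<^sub>k\<^sub>|\<^sub>k\<^sub>-\<^sub>1\<close>; it only reads the components of \<open>h\<close> belonging to \<open>F\<^sub>k\<^sub>-\<^sub>1\<close>.\<close>

primrec predictor :: "'u hmm \<Rightarrow> 'u info \<Rightarrow> nat \<Rightarrow> real vec" where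
  "predictor M h 0 = init_dist M"
| "predictor M h (Suc k) =
     (let v = likelihood_mat M (prev_ctrl M (snd h) k) (fst h k) *\<^sub>v predictor M h k
      in (1 / (vec (nst M) (\<lambda>_. 1) \<bullet> v)) \<cdot>\<^sub>v (trans_mat M *\<^sub>v v))"

definition mean_mat :: "'u hmm \<Rightarrow> 'u \<Rightarrow> real mat" where
  "mean_mat M u = mat_of_cols (odim M u) (map (omean M u) [0..<nst M])"

definition avg_cov :: "'u hmm \<Rightarrow> 'u \<Rightarrow> real vec \<Rightarrow> real mat" where
  "avg_cov M u p =
     mat (odim M u) (odim M u) (\<lambda>(a, b). \<Sum>i<nst M. p $ i * ocov M u i $$ (a, b))"

definition cat_cov :: "real vec \<Rightarrow> real mat" where
  "cat_cov p = diag_vec p - outer_prod p p"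

definition gain :: "'u hmm \<Rightarrow> 'u \<Rightarrow> real vec \<Rightarrow> real mat" where
  "gain M u p =
     (let S = cat_cov p; C = mean_mat M u
      in S * transpose_mat C * mat_inv (C * S * transpose_mat C + avg_cov M u p))"

definition filter_est :: "'u hmm \<Rightarrow> 'u \<Rightarrow> real vec \<Rightarrow> real vec \<Rightarrow> real vec" where
  "filter_est M u p y = p + gain M u p *\<^sub>v (y - mean_mat M u *\<^sub>v p)"

text \<open>The stage cost is evaluated at (an extension of) \<open>F\<^sub>k\<close>.\<close>

definition stage_cost :: "'u hmm \<Rightarrow> nat \<Rightarrow> 'u info \<Rightarrow> real" where
  "stage_cost M k h =
     (let u = prev_ctrl M (snd h) k
      in trace (cat_cov (filter_est M u (predictor M h k) (obs_vec M u (fst h k)))))"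

section \<open>Expectations under a policy\<close>

text \<open>
  \<open>path_dens\<close> is the joint density of \<open>x\<^sub>0, \<dots>, x\<^sub>k, y\<^sub>0, \<dots>, y\<^sub>k\<close> when the controls in \<open>h\<close> are
  applied, and \<open>info_dens\<close> is the marginal density of the observations.
\<close>

definition path_dens :: "'u hmm \<Rightarrow> nat \<Rightarrow> (nat \<Rightarrow> nat) \<Rightarrow> 'u info \<Rightarrow> real" where
  "path_dens M k xs h =
     init_dist M $ xs 0 * (\<Prod>t<k. trans_mat M $$ (xs (Suc t), xs t)) *
     (\<Prod>t\<le>k. obs_dens M (prev_ctrl M (snd h) t) (xs t) (fst h t))"

definition info_dens :: "'u hmm \<Rightarrow> nat \<Rightarrow> 'u info \<Rightarrow> real" where
  "info_dens M k h = (\<Sum>xs \<in> {..k} \<rightarrow>\<^sub>E {..<nst M}. path_dens M k xs h)"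

text \<open>
  \<open>rollout M \<eta> m t G h\<close> integrates \<open>G\<close> over \<open>y\<^sub>t\<^sub>+\<^sub>1, \<dots>, y\<^sub>t\<^sub>+\<^sub>m\<close> with respect to Lebesgue measure,
  starting from \<open>F\<^sub>t = h\<close> and with \<open>u\<^sub>t, \<dots>, u\<^sub>t\<^sub>+\<^sub>m\<^sub>-\<^sub>1\<close> chosen by \<open>\<eta>\<close>. The integrals are iterated because
  the space of each observation depends on the preceding control.
\<close>

primrec rollout ::
    "'u hmm \<Rightarrow> (nat \<Rightarrow> 'u info \<Rightarrow> 'u) \<Rightarrow> nat \<Rightarrow> nat \<Rightarrow> ('u info \<Rightarrow> real) \<Rightarrow> 'u info \<Rightarrow> real" where
  "rollout M \<eta> 0 t G h = G h"
| "rollout M \<eta> (Suc m) t G h =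
     (\<integral>y. rollout M \<eta> m (Suc t) G (info_snoc (Suc t) h y (\<eta> t h)) \<partial>obs_space M (\<eta> t h))"

definition info0 :: "(nat \<Rightarrow> real) \<Rightarrow> 'u info" where
  "info0 y = ((\<lambda>_. undefined)(0 := y), \<lambda>_. undefined)"

definition policy_expect ::
    "'u hmm \<Rightarrow> (nat \<Rightarrow> 'u info \<Rightarrow> 'u) \<Rightarrow> nat \<Rightarrow> ('u info \<Rightarrow> real) \<Rightarrow> real" where
  "policy_expect M \<eta> k G =
     (\<integral>y. rollout M \<eta> k 0 (\<lambda>h. info_dens M k h * G h) (info0 y) \<partial>obs_space M (ctrl0 M))"

text \<open>
  The conditional expectation of \<open>G(F\<^sub>L)\<close> given \<open>F\<^sub>t = h\<close>, as the integral of the joint density over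
  the future divided by the marginal density of \<open>h\<close>. This fixes the version of the conditional
  expectation at every \<open>h\<close>, and only the rules \<open>\<eta>\<^sub>t, \<dots>, \<eta>\<^sub>L\<^sub>-\<^sub>1\<close> matter. Lemma
  \<open>cond_expect_averaging\<close> below is the defining property of the conditional expectation.
\<close>

definition cond_expect ::
    "'u hmm \<Rightarrow> (nat \<Rightarrow> 'u info \<Rightarrow> 'u) \<Rightarrow> nat \<Rightarrow> nat \<Rightarrow> ('u info \<Rightarrow> real) \<Rightarrow> 'u info \<Rightarrow> real" where
  "cond_expect M \<eta> L t G h =
     rollout M \<eta> (L - t) t (\<lambda>h'. info_dens M L h' * G h') h / info_dens M t h"

section \<open>The control problem\<close>

definition total_cost :: "'u hmm \<Rightarrow> nat \<Rightarrow> (nat \<Rightarrow> 'u info \<Rightarrow> 'u) \<Rightarrow> real" where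
  "total_cost M L \<eta> = policy_expect M \<eta> L (\<lambda>h. \<Sum>k=1..L. stage_cost M k h)"

definition remaining_cost ::
    "'u hmm \<Rightarrow> nat \<Rightarrow> (nat \<Rightarrow> 'u info \<Rightarrow> 'u) \<Rightarrow> nat \<Rightarrow> 'u info \<Rightarrow> real" where
  "remaining_cost M L \<eta> k h = cond_expect M \<eta> L (k - 1) (\<lambda>h'. \<Sum>t=k..L. stage_cost M t h') h"

text \<open>
  \<open>LEAST\<close> on the reals denotes a minimum, not an infimum: it is unspecified unless the minimum is
  attained by some decision rules.
\<close>

definition cost_to_go :: "'u hmm \<Rightarrow> nat \<Rightarrow> nat \<Rightarrow> 'u info \<Rightarrow> real" where
  "cost_to_go M L k h =
     (LEAST c. \<exists>\<eta>. decision_rules M {k - 1..<L} \<eta> \<and> c = remaining_cost M L \<eta> k h)"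

text \<open>The law of \<open>y\<^sub>k\<close> given \<open>F\<^sub>k\<^sub>-\<^sub>1 = h\<close> and \<open>u\<^sub>k\<^sub>-\<^sub>1 = u\<close>.\<close>

definition pred_obs_law :: "'u hmm \<Rightarrow> nat \<Rightarrow> 'u info \<Rightarrow> 'u \<Rightarrow> (nat \<Rightarrow> real) measure" where
  "pred_obs_law M k h u =
     density (obs_space M u) (\<lambda>y. ennreal (\<Sum>i<nst M. predictor M h k $ i * obs_dens M u i y))"

section \<open>Averaging property of the conditional expectation\<close>

lemma rollout_add:
  "rollout M \<eta> (a + b) t G h = rollout M \<eta> a t (rollout M \<eta> b (t + a) G) h"
  by (induction a arbitrary: t h) simp_all

lemma info0_in_info_vecs:
  assumes "y \<in> space (obs_space M (ctrl0 M))"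
  shows "info0 y \<in> info_vecs M 0"
  using assms
  by (auto simp: info0_def info_vecs_def obs_hist_def space_PiM prev_ctrl_def PiE_def
      extensional_def)

lemma info_snoc_in_info_vecs:
  assumes h: "h \<in> info_vecs M t" and u: "u \<in> ctrls M" and y: "y \<in> space (obs_space M u)"
  shows "info_snoc (Suc t) h y u \<in> info_vecs M (Suc t)"
proof -
  obtain ys us where hh: "h = (ys, us)" by force
  have us: "us \<in> {..<t} \<rightarrow>\<^sub>E ctrls M"
    and ys: "ys \<in> (\<Pi>\<^sub>E s\<in>{..t}. space (obs_space M (prev_ctrl M us s)))"
    using h by (auto simp: hh info_vecs_def obs_hist_def space_PiM)
  have "us(t := u) \<in> {..<Suc t} \<rightarrow>\<^sub>E ctrls M"
    using us u by (auto simp: PiE_def Pi_def extensional_def less_Suc_eq)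
  moreover have "ys(Suc t := y) \<in> (\<Pi>\<^sub>E s\<in>{..Suc t}. space (obs_space M (prev_ctrl M (us(t := u)) s)))"
  proof (rule PiE_I)
    fix s assume "s \<in> {..Suc t}"
    then consider "s = Suc t" | "s \<le> t" by force
    then show "(ys(Suc t := y)) s \<in> space (obs_space M (prev_ctrl M (us(t := u)) s))"
    proof cases
      case 1
      then show ?thesis using y by (simp add: prev_ctrl_def)
    next
      case 2
      then have "prev_ctrl M (us(t := u)) s = prev_ctrl M us s" by (auto simp: prev_ctrl_def)
      with 2 PiE_mem[OF ys, of s] show ?thesis by simp
    qed
  next
    fix s assume "s \<notin> {..Suc t}"
    then show "(ys(Suc t := y)) s = undefined" using PiE_arb[OF ys, of s] by auto
  qed
  ultimately show ?thesis
    by (simp add: hh info_snoc_def info_vecs_def obs_hist_def space_PiM)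
qed

lemma decision_rule_in_ctrls:
  assumes "decision_rule M t r" "h \<in> info_vecs M t"
  shows "r h \<in> ctrls M"
proof -
  obtain ys us where "h = (ys, us)" by force
  with assms have "(\<lambda>ys. r (ys, us)) \<in> measurable (obs_hist M t us) (count_space (ctrls M))"
    "ys \<in> space (obs_hist M t us)"
    by (auto simp: decision_rule_def info_vecs_def)
  from measurable_space[OF this] show ?thesis by (simp add: \<open>h = (ys, us)\<close>)
qed

lemma rollout_cong:
  assumes "decision_rules M {t..<t + m} \<eta>" "h \<in> info_vecs M t"
    and "\<And>h'. h' \<in> info_vecs M (t + m) \<Longrightarrow> G h' = G' h'"
  shows "rollout M \<eta> m t G h = rollout M \<eta> m t G' h"
  using assms
proof (induction m arbitrary: t h)
  case (Suc m)
  have u: "\<eta> t h \<in> ctrls M"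
    using Suc.prems by (intro decision_rule_in_ctrls) (auto simp: decision_rules_def)
  show ?case
    unfolding rollout.simps
    by (intro Bochner_Integration.integral_cong refl Suc.IH info_snoc_in_info_vecs u Suc.prems)
      (use Suc.prems in \<open>auto simp: decision_rules_def\<close>)
qed simp

lemma info_restrict_snoc:
  "s \<le> t \<Longrightarrow> info_restrict s (info_snoc (Suc t) h y u) = info_restrict s h"
  by (auto simp: info_restrict_def info_snoc_def restrict_def fun_eq_iff)

lemma info_restrict_id:
  "h \<in> info_vecs M t \<Longrightarrow> info_restrict t h = h"
  by (cases h) (auto simp: info_restrict_def info_vecs_def obs_hist_def space_PiM PiE_restrict)

lemma rollout_pull_out:
  "s \<le> t \<Longrightarrow> rollout M \<eta> m t (\<lambda>h'. \<phi> (info_restrict s h') * G h') h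
     = \<phi> (info_restrict s h) * rollout M \<eta> m t G h"
  by (induction m arbitrary: t h) (simp_all add: info_restrict_snoc)

lemma cond_expect_averaging:
  assumes "t \<le> L" "decision_rules M {0..<L} \<eta>"
    and "\<And>h. h \<in> info_vecs M t \<Longrightarrow> info_dens M t h \<noteq> 0"
  shows "policy_expect M \<eta> L (\<lambda>h. \<phi> (info_restrict t h) * G h)
       = policy_expect M \<eta> t (\<lambda>h. \<phi> h * cond_expect M \<eta> L t G h)"
proof -
  have *: "rollout M \<eta> L 0 (\<lambda>h. info_dens M L h * (\<phi> (info_restrict t h) * G h)) (info0 y)
      = rollout M \<eta> t 0 (\<lambda>h. info_dens M t h * (\<phi> h * cond_expect M \<eta> L t G h)) (info0 y)"
    if y: "y \<in> space (obs_space M (ctrl0 M))" for y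
  proof -
    have "rollout M \<eta> L 0 (\<lambda>h. info_dens M L h * (\<phi> (info_restrict t h) * G h)) (info0 y)
        = rollout M \<eta> t 0 (rollout M \<eta> (L - t) t
            (\<lambda>h. \<phi> (info_restrict t h) * (info_dens M L h * G h))) (info0 y)"
      using rollout_add[of M \<eta> t "L - t" 0] assms(1) by (simp add: mult.left_commute)
    also have "\<dots> = rollout M \<eta> t 0
        (\<lambda>h. info_dens M t h * (\<phi> h * cond_expect M \<eta> L t G h)) (info0 y)"
    proof (rule rollout_cong)
      fix h assume h: "h \<in> info_vecs M (0 + t)"
      have "rollout M \<eta> (L - t) t (\<lambda>h. \<phi> (info_restrict t h) * (info_dens M L h * G h)) h
          = \<phi> h * rollout M \<eta> (L - t) t (\<lambda>h. info_dens M L h * G h) h"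
        using h info_restrict_id[of h M t]
          rollout_pull_out[of t t M \<eta> "L - t" \<phi> "\<lambda>h. info_dens M L h * G h" h] by simp
      then show "rollout M \<eta> (L - t) t (\<lambda>h. \<phi> (info_restrict t h) * (info_dens M L h * G h)) h
          = info_dens M t h * (\<phi> h * cond_expect M \<eta> L t G h)"
        using h assms(3)[of h] by (simp add: cond_expect_def)
    qed (use assms y in \<open>auto simp: decision_rules_def intro: info0_in_info_vecs\<close>)
    finally show ?thesis .
  qed
  show ?thesis
    unfolding policy_expect_def by (intro Bochner_Integration.integral_cong refl *)
qed

end

theory Submission
  imports Defs
begin

text \<open>The filter estimate is affine in the observation and may leave the simplex. The stage
  cost, a sum of terms \<open>e - e * e\<close> over its entries \<open>e\<close>, can then be
  negative and arbitrarily large in modulus. Integrability therefore has to come from Gaussian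
  second moments. It cannot be skipped: the Bochner integral of a nonintegrable function is 0, which
  would break both additivity and monotonicity. Each integration turns the quadratic growth in the
  newest observation into a constant independent of the predictor, so the growth does not accumulate
  over the stages. Nothing holds merely almost everywhere: Gaussian densities are positive at every
  point, so every normaliser and every density used as a divisor is nonzero at each information
  vector. Since the space of an observation depends on the preceding control, there is no single
  product space for all histories. Measurability is handled for one control history at a time, and
  expectations one stage at a time.\<close>

text \<open>
  Normalising the joint density of states and observations step by step shows that the density of
  \<open>F\<^sub>t\<^sub>+\<^sub>1\<close> is that of \<open>F\<^sub>t\<close> times the predictive mixture density of \<open>y\<^sub>t\<^sub>+\<^sub>1\<close>, so the remaining cost
  of a policy satisfies a one-step recursion. The stage cost is quadratic in the observation, with
  coefficients bounded uniformly over the simplex because the innovation covariance dominates a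
  fixed multiple of the identity. Hence the expected costs are bounded, all integrals split, and
  monotonicity of the one-step expectation bounds the cost of every policy from below by the
  dynamic-programming value. As there are finitely many controls, a measurable choice of a minimiser
  at each stage attains this bound at all information vectors simultaneously, so the minimum defining
  the cost-to-go exists.
\<close>

section \<open>Gaussian integrals by Schur complements\<close>

text \<open>The argument is a function instead of a vector, so that points of the product space can
  be inserted directly and a form of size \<open>d\<close> can be evaluated at a function carrying
  more coordinates. Inductions on the dimension rely on this.\<close>

definition quad_form :: "nat \<Rightarrow> real mat \<Rightarrow> (nat \<Rightarrow> real) \<Rightarrow> real" where
  "quad_form d A y = (\<Sum>i<d. \<Sum>j<d. A $$ (i, j) * y i * y j)"

lemma scalar_prod_mult_mat_vec:
  assumes "A \<in> carrier_mat d d"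
  shows "vec d y \<bullet> (A *\<^sub>v vec d y) = quad_form d A y"
  using assms
  by (auto simp: scalar_prod_def quad_form_def sum_distrib_left lessThan_atLeast0 mult_ac
      intro!: sum.cong)

lemma quad_form_cong: "(\<And>i. i < d \<Longrightarrow> y i = z i) \<Longrightarrow> quad_form d A y = quad_form d A z"
  by (simp add: quad_form_def)

lemma pos_def_iff_quad_form:
  "pos_def d A \<longleftrightarrow> A \<in> carrier_mat d d \<and> (\<forall>i<d. \<forall>j<d. A $$ (i, j) = A $$ (j, i)) \<and>
     (\<forall>y. (\<exists>i<d. y i \<noteq> 0) \<longrightarrow> 0 < quad_form d A y)" (is "?L \<longleftrightarrow> ?R")
proof
  assume L: ?L
  then have A: "A \<in> carrier_mat d d" and t: "transpose_mat A = A"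
    and p: "\<And>v. v \<in> carrier_vec d \<Longrightarrow> v \<noteq> 0\<^sub>v d \<Longrightarrow> 0 < v \<bullet> (A *\<^sub>v v)"
    by (auto simp: pos_def_def)
  have "A $$ (i, j) = A $$ (j, i)" if "i < d" "j < d" for i j
    using that A t by (metis carrier_matD index_transpose_mat(1))
  moreover have "0 < quad_form d A y" if "\<exists>i<d. y i \<noteq> 0" for y
  proof -
    have "vec d y \<noteq> 0\<^sub>v d" using that by (metis index_vec index_zero_vec(1))
    from p[OF _ this] show ?thesis using scalar_prod_mult_mat_vec[OF A] by simp
  qed
  ultimately show ?R using A by blast
next
  assume R: ?R
  then have A: "A \<in> carrier_mat d d" by blast
  have "transpose_mat A = A" using R by (intro eq_matI) auto
  moreover have "0 < v \<bullet> (A *\<^sub>v v)" if v: "v \<in> carrier_vec d" "v \<noteq> 0\<^sub>v d" for v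
  proof -
    have "\<exists>i<d. v $ i \<noteq> 0" using v by (metis carrier_vecD eq_vecI index_zero_vec)
    with R have "0 < quad_form d A (($) v)" by blast
    moreover have "vec d (($) v) = v" using v by auto
    ultimately show ?thesis using scalar_prod_mult_mat_vec[OF A, of "($) v"] by simp
  qed
  ultimately show ?L using A by (auto simp: pos_def_def)
qed

text \<open>The pivot is the last index, so that the complement keeps the indices below
  \<open>d\<close> and no renumbering occurs when one coordinate is split off.\<close>

definition schur :: "nat \<Rightarrow> real mat \<Rightarrow> real mat" where
  "schur d A = mat d d (\<lambda>(i, j). A $$ (i, j) - A $$ (i, d) * A $$ (d, j) / A $$ (d, d))"

text \<open>Completing the square in the last coordinate: what remains of the form is the Schur
  complement.\<close>

lemma quad_form_schur:
  assumes "\<And>i. i < d \<Longrightarrow> A $$ (i, d) = A $$ (d, i)" "A $$ (d, d) \<noteq> 0"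
  shows "quad_form (Suc d) A y =
    A $$ (d, d) * (y d + (\<Sum>i<d. A $$ (d, i) * y i) / A $$ (d, d))\<^sup>2 + quad_form d (schur d A) y"
proof -
  define b where "b = (\<Sum>i<d. A $$ (d, i) * y i)"
  define a where "a = A $$ (d, d)"
  have "quad_form d (schur d A) y =
    (\<Sum>i<d. \<Sum>j<d. A $$ (i, j) * y i * y j - (A $$ (d, i) * y i) * (A $$ (d, j) * y j) / a)"
    unfolding quad_form_def schur_def a_def using assms
    by (intro sum.cong refl) (simp add: algebra_simps)
  also have "\<dots> = quad_form d A y - b * b / a"
    by (simp add: sum_subtractf quad_form_def b_def sum_product sum_divide_distrib)
  finally have 1: "quad_form d (schur d A) y = quad_form d A y - b * b / a" .
  have "quad_form (Suc d) A y = quad_form d A y + (\<Sum>i<d. A $$ (i, d) * y i * y d)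
     + ((\<Sum>j<d. A $$ (d, j) * y d * y j) + a * y d * y d)"
    by (simp add: quad_form_def sum.distrib a_def)
  also have "(\<Sum>i<d. A $$ (i, d) * y i * y d) = b * y d"
    unfolding b_def sum_distrib_right using assms by (intro sum.cong) auto
  also have "(\<Sum>j<d. A $$ (d, j) * y d * y j) = b * y d"
    unfolding b_def sum_distrib_right by (intro sum.cong) auto
  finally have 2: "quad_form (Suc d) A y = quad_form d A y + b * y d + (b * y d + a * y d * y d)" .
  show ?thesis
    unfolding 1 2 using assms(2)
    unfolding a_def[symmetric] b_def[symmetric] by (simp add: field_simps power2_eq_square)
qed

lemma pos_def_diag_pos: "pos_def d A \<Longrightarrow> k < d \<Longrightarrow> 0 < A $$ (k, k)"
proof -
  assume A: "pos_def d A" and k: "k < d"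
  let ?y = "\<lambda>i. if i = k then 1 else 0 :: real"
  have "0 < quad_form d A ?y" using A k by (auto simp: pos_def_iff_quad_form)
  also have "quad_form d A ?y = A $$ (k, k)"
    using k by (simp add: quad_form_def if_distrib[of "\<lambda>x. _ * x"] cong: if_cong)
  finally show ?thesis .
qed

lemma pos_def_schur:
  assumes "pos_def (Suc d) A"
  shows "pos_def d (schur d A)"
proof -
  have a: "0 < A $$ (d, d)" using assms by (simp add: pos_def_diag_pos)
  have s: "\<And>i j. i < Suc d \<Longrightarrow> j < Suc d \<Longrightarrow> A $$ (i, j) = A $$ (j, i)"
    using assms by (auto simp: pos_def_iff_quad_form)
  have "0 < quad_form d (schur d A) y" if y: "\<exists>i<d. y i \<noteq> 0" for y
  proof -
    \<comment> \<open>This last coordinate makes the completed square vanish, leaving only the form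
      of the complement.\<close>
    let ?z = "y(d := - (\<Sum>i<d. A $$ (d, i) * y i) / A $$ (d, d))"
    have "\<exists>i<Suc d. ?z i \<noteq> 0" using y by auto
    with assms have "0 < quad_form (Suc d) A ?z" by (auto simp: pos_def_iff_quad_form)
    also have "\<dots> = quad_form d (schur d A) ?z"
      using quad_form_schur[of d A ?z] s a by simp
    also have "\<dots> = quad_form d (schur d A) y" by (intro quad_form_cong) auto
    finally show ?thesis .
  qed
  then show ?thesis using s by (auto simp: pos_def_iff_quad_form schur_def)
qed

text \<open>Block elimination: \<open>A\<close> factors as \<open>U * B\<close>, where
  \<open>U\<close> is upper triangular with unit diagonal and \<open>B\<close> is block lower
  triangular with the Schur complement and the pivot as diagonal blocks.\<close>

lemma det_schur:
  assumes A: "A \<in> carrier_mat (Suc d) (Suc d)" and a: "A $$ (d, d) \<noteq> 0"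
  shows "det A = A $$ (d, d) * det (schur d A)"
proof -
  define U where "U = four_block_mat (1\<^sub>m d) (mat d 1 (\<lambda>(i, _). A $$ (i, d) / A $$ (d, d))) (0\<^sub>m 1 d) (1\<^sub>m 1)"
  define B where "B = four_block_mat (schur d A) (0\<^sub>m d 1) (mat 1 d (\<lambda>(_, j). A $$ (d, j))) (mat 1 1 (\<lambda>_. A $$ (d, d)))"
  have S: "schur d A \<in> carrier_mat d d" by (simp add: schur_def)
  have "U * B = A"
    unfolding U_def B_def
    apply (subst mult_four_block_mat[of _ d d _ 1 _ 1 _ _ d _ 1])
    using A a S by (auto simp: schur_def scalar_prod_def less_Suc_eq intro!: eq_matI)
  moreover have "U \<in> carrier_mat (Suc d) (Suc d)" "B \<in> carrier_mat (Suc d) (Suc d)"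
    unfolding U_def B_def using S by auto
  ultimately have "det A = det U * det B" by (metis det_mult)
  also have "det U = 1" unfolding U_def
    by (subst det_four_block_mat_lower_left_zero) auto
  also have "det B = det (schur d A) * A $$ (d, d)" unfolding B_def
    by (subst det_four_block_mat_upper_right_zero) (use S in \<open>auto simp: det_single\<close>)
  finally show ?thesis by simp
qed

lemma pos_def_det_pos: "pos_def d A \<Longrightarrow> 0 < det A"
proof (induction d arbitrary: A)
  case 0
  then have "A \<in> carrier_mat 0 0" by (simp add: pos_def_def)
  then show ?case by (simp add: det_dim_zero)
next
  case (Suc d)
  then have A: "A \<in> carrier_mat (Suc d) (Suc d)" by (simp add: pos_def_def)
  have "0 < A $$ (d, d)" using Suc.prems by (simp add: pos_def_diag_pos)
  with det_schur[OF A] Suc.IH[OF pos_def_schur[OF Suc.prems]] show ?case by simp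
qed

text \<open>Induction along Schur complements takes the place of a smallest eigenvalue. The first
  \<open>d\<close> coordinates are controlled by the complement, the last one by the completed
  square, up to a shift that Cauchy-Schwarz bounds by the first \<open>d\<close>
  coordinates.\<close>

lemma pos_def_coercive: "pos_def d A \<Longrightarrow> \<exists>K>0. \<forall>y. (\<Sum>i<d. (y i)\<^sup>2) \<le> K * quad_form d A y"
proof (induction d arbitrary: A)
  case 0
  then show ?case by (auto simp: quad_form_def intro: exI[of _ 1])
next
  case (Suc d)
  have a: "0 < A $$ (d, d)" using Suc.prems by (simp add: pos_def_diag_pos)
  have s: "\<And>i j. i < Suc d \<Longrightarrow> j < Suc d \<Longrightarrow> A $$ (i, j) = A $$ (j, i)"
    using Suc.prems by (auto simp: pos_def_iff_quad_form)
  from Suc.IH[OF pos_def_schur[OF Suc.prems]] obtain K where K: "K > 0"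
    "\<And>y. (\<Sum>i<d. (y i)\<^sup>2) \<le> K * quad_form d (schur d A) y" by blast
  define a where "a = A $$ (d, d)"
  define B where "B = (\<Sum>i<d. (A $$ (d, i) / a)\<^sup>2)"
  \<comment> \<open>Below, the squared norm is at most \<open>2 / a\<close> times the completed
    square plus \<open>K + 2 * B * K\<close> times the complement; \<open>K'\<close> adds the two
    coefficients and so dominates both.\<close>
  define K' where "K' = K + 2 / a + 2 * B * K"
  have B: "B \<ge> 0" unfolding B_def by (simp add: sum_nonneg)
  have a: "a > 0" using a by (simp add: a_def)
  have "(\<Sum>i<Suc d. (y i)\<^sup>2) \<le> K' * quad_form (Suc d) A y" for y
  proof -
    define q where "q = quad_form d (schur d A) y"
    define w where "w = (\<Sum>i<d. A $$ (d, i) * y i) / a"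
    define t where "t = a * (y d + w)\<^sup>2"
    have q: "quad_form (Suc d) A y = t + q"
      using quad_form_schur[of d A y] s a by (simp add: a_def q_def w_def t_def)
    have S: "(\<Sum>i<d. (y i)\<^sup>2) \<le> K * q" using K by (simp add: q_def)
    have "w = (\<Sum>i<d. (A $$ (d, i) / a) * y i)" by (simp add: w_def sum_divide_distrib)
    then have "w\<^sup>2 \<le> B * (\<Sum>i<d. (y i)\<^sup>2)" unfolding B_def
      using Cauchy_Schwarz_ineq_sum[of "\<lambda>i. A $$ (d, i) / a" y "{..<d}"] by simp
    also have "\<dots> \<le> B * (K * q)" using S B by (rule mult_left_mono)
    finally have w: "w\<^sup>2 \<le> B * (K * q)" .
    have q0: "0 \<le> q" using S K(1) 
      by (meson order_trans sum_nonneg zero_le_mult_iff zero_le_power2 not_less)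
    have t0: "0 \<le> t" using a by (simp add: t_def)
    have "(y d)\<^sup>2 \<le> 2 * (y d + w)\<^sup>2 + 2 * w\<^sup>2"
      using zero_le_power2[of "y d + w + w"] by (simp add: power2_eq_square algebra_simps)
    also have "\<dots> = 2 / a * t + 2 * w\<^sup>2" using a by (simp add: t_def)
    finally have "(\<Sum>i<Suc d. (y i)\<^sup>2) \<le> K * q + 2 / a * t + 2 * B * K * q" using S w by simp
    also have "\<dots> \<le> K' * (t + q)"
    proof -
      have "0 \<le> K * t + 2 * B * K * t + 2 / a * q"
        using K(1) B a t0 q0 by (intro add_nonneg_nonneg mult_nonneg_nonneg) auto
      then show ?thesis by (simp add: K'_def algebra_simps add_divide_distrib)
    qed
    finally show ?thesis by (simp add: q)
  qed
  moreover have "K' > 0" unfolding K'_def using K(1) B a by (simp add: add_pos_nonneg)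
  ultimately show ?case by blast
qed

section \<open>Gaussian integrals in one and several variables\<close>

lemma nn_integral_exp_square:
  assumes "a > (0::real)"
  shows "(\<integral>\<^sup>+z. ennreal (exp (- (a * (z + c)\<^sup>2) / 2)) \<partial>lborel) = ennreal (sqrt (2 * pi / a))"
proof -
  let ?s = "1 / sqrt a"
  have s: "?s > 0" "?s\<^sup>2 = 1 / a" using assms by (auto simp: power_divide)
  have "exp (- (a * (z + c)\<^sup>2) / 2) = sqrt (2 * pi / a) * normal_density (- c) ?s z" for z
    using assms s(2) by (simp add: normal_density_def real_sqrt_divide)
  moreover have "(\<integral>\<^sup>+z. ennreal (normal_density (- c) ?s z) \<partial>lborel) = 1"
    by (subst nn_integral_eq_integral)
      (use s(1) in \<open>auto intro: integrable_normal_density simp: integral_normal_density\<close>)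
  ultimately show ?thesis
    using assms by (simp add: ennreal_mult nn_integral_cmult)
qed

lemma measurable_quad_form [measurable]:
  "(\<lambda>y. quad_form d A (\<lambda>i. y i - m i)) \<in> borel_measurable (\<Pi>\<^sub>M i\<in>{..<d}. lborel)"
  unfolding quad_form_def by measurable

text \<open>The last coordinate is integrated first. After completing the square it contributes a
  shifted one-dimensional Gaussian whose value does not depend on the other coordinates; the
  complement is left to the induction and \<open>det_schur\<close> multiplies the two determinants.
  Nonnegative integrals let Tonelli apply before integrability is known.\<close>

lemma nn_integral_exp_quad_form:
  "pos_def d A \<Longrightarrow> (\<integral>\<^sup>+y. ennreal (exp (- quad_form d A (\<lambda>i. y i - m i) / 2)) \<partial>(\<Pi>\<^sub>M i\<in>{..<d}. lborel))
     = ennreal (sqrt ((2 * pi) ^ d / det A))"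
proof (induction d arbitrary: A)
  case 0
  then have "A \<in> carrier_mat 0 0" by (simp add: pos_def_def)
  then show ?case
    by (simp add: det_dim_zero quad_form_def PiM_empty nn_integral_count_space_finite)
next
  case (Suc d)
  interpret product_sigma_finite "\<lambda>_::nat. lborel :: real measure"
    by standard
  have A: "A \<in> carrier_mat (Suc d) (Suc d)" using Suc.prems by (simp add: pos_def_def)
  have a: "0 < A $$ (d, d)" using Suc.prems by (simp add: pos_def_diag_pos)
  have s: "\<And>i j. i < Suc d \<Longrightarrow> j < Suc d \<Longrightarrow> A $$ (i, j) = A $$ (j, i)"
    using Suc.prems by (auto simp: pos_def_iff_quad_form)
  define w where "w y = - m d + (\<Sum>i<d. A $$ (d, i) * (y i - m i)) / A $$ (d, d)" for y :: "nat \<Rightarrow> real"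
  let ?q = "\<lambda>y. quad_form d (schur d A) (\<lambda>i. y i - m i)"
  have *: "quad_form (Suc d) A (\<lambda>i. (y(d := z)) i - m i) = A $$ (d, d) * (z + w y)\<^sup>2 + ?q y" for y z
  proof -
    have "quad_form (Suc d) A (\<lambda>i. (y(d := z)) i - m i) =
        A $$ (d, d) * ((z - m d) + (\<Sum>i<d. A $$ (d, i) * (y i - m i)) / A $$ (d, d))\<^sup>2
          + quad_form d (schur d A) (\<lambda>i. (y(d := z)) i - m i)"
      by (subst quad_form_schur) (use s a in auto)
    also have "quad_form d (schur d A) (\<lambda>i. (y(d := z)) i - m i) = ?q y"
      by (intro quad_form_cong) auto
    finally show ?thesis by (simp add: w_def algebra_simps)
  qed
  have "(\<integral>\<^sup>+y. ennreal (exp (- quad_form (Suc d) A (\<lambda>i. y i - m i) / 2)) \<partial>(\<Pi>\<^sub>M i\<in>{..<Suc d}. lborel))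
    = (\<integral>\<^sup>+y. \<integral>\<^sup>+z. ennreal (exp (- quad_form (Suc d) A (\<lambda>i. (y(d := z)) i - m i) / 2)) \<partial>lborel
        \<partial>(\<Pi>\<^sub>M i\<in>{..<d}. lborel))"
    unfolding lessThan_Suc
  proof (rule product_nn_integral_insert)
    show "(\<lambda>y. ennreal (exp (- quad_form (Suc d) A (\<lambda>i. y i - m i) / 2)))
        \<in> borel_measurable (\<Pi>\<^sub>M i\<in>insert d {..<d}. lborel)"
      unfolding lessThan_Suc[symmetric] by measurable
  qed simp_all
  also have "\<dots> = (\<integral>\<^sup>+y. ennreal (exp (- ?q y / 2)) * (\<integral>\<^sup>+z. ennreal (exp (- (A $$ (d, d) * (z + w y)\<^sup>2) / 2)) \<partial>lborel)
        \<partial>(\<Pi>\<^sub>M i\<in>{..<d}. lborel))"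
    unfolding *
    by (intro nn_integral_cong, subst nn_integral_cmult[symmetric])
      (auto simp: ennreal_mult[symmetric] exp_add[symmetric] field_simps)
  also have "\<dots> = (\<integral>\<^sup>+y. ennreal (exp (- ?q y / 2)) \<partial>(\<Pi>\<^sub>M i\<in>{..<d}. lborel)) * ennreal (sqrt (2 * pi / A $$ (d, d)))"
    unfolding nn_integral_exp_square[OF a] by (subst nn_integral_multc) auto
  also have "\<dots> = ennreal (sqrt ((2 * pi) ^ Suc d / det A))"
    unfolding Suc.IH[OF pos_def_schur[OF Suc.prems]] det_schur[OF A less_imp_neq[OF a, symmetric]]
    using a pos_def_det_pos[OF pos_def_schur[OF Suc.prems]]
    by (simp add: ennreal_mult[symmetric] real_sqrt_mult[symmetric] mult_ac)
  finally show ?case .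
qed

section \<open>Inverse matrices and positive definiteness\<close>

lemma mat_inv_correct:
  assumes A: "A \<in> carrier_mat n n" and d: "det A \<noteq> 0"
  shows "mat_inv A \<in> carrier_mat n n" "A * mat_inv A = 1\<^sub>m n" "mat_inv A * A = 1\<^sub>m n"
proof -
  have "A \<in> Units (ring_mat TYPE(real) n ())" using A d by (rule det_non_zero_imp_unit)
  then obtain B where "mat_inverse A = Some B"
    using mat_inverse(1)[OF A, where b = "()"] by (cases "mat_inverse A") auto
  then show "mat_inv A \<in> carrier_mat n n" "A * mat_inv A = 1\<^sub>m n" "mat_inv A * A = 1\<^sub>m n"
    using mat_inverse(2)[OF A] by (simp_all add: mat_inv_def)
qed

text \<open>Gauss-Jordan elimination branches on its entries; the adjugate formula exhibits the
  inverse as a rational function of them, which gives measurability later.\<close>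

lemma mat_inv_eq_adj_mat:
  assumes A: "A \<in> carrier_mat n n" and d: "det A \<noteq> 0"
  shows "mat_inv A = (1 / det A) \<cdot>\<^sub>m adj_mat A"
proof -
  note I = mat_inv_correct[OF A d] and J = adj_mat[OF A]
  have "adj_mat A = mat_inv A * A * adj_mat A" using I(3) J(1) by simp
  also have "\<dots> = mat_inv A * (det A \<cdot>\<^sub>m 1\<^sub>m n)" using I(1) A J by (simp add: assoc_mult_mat)
  also have "\<dots> = det A \<cdot>\<^sub>m mat_inv A"
    using I(1) mult_smult_distrib[OF I(1), of "1\<^sub>m n" n "det A"] by simp
  finally show ?thesis using d I(1) by (intro eq_matI) auto
qed

text \<open>With \<open>w = mat_inv Q *\<^sub>v v\<close>, the form of the inverse at
  \<open>v\<close> is the form of \<open>Q\<close> at \<open>w\<close>.\<close>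

lemma pos_def_mat_inv:
  assumes "pos_def d Q"
  shows "pos_def d (mat_inv Q)" "det (mat_inv Q) = 1 / det Q"
proof -
  have Q: "Q \<in> carrier_mat d d" and t: "transpose_mat Q = Q"
    and p: "\<And>v. v \<in> carrier_vec d \<Longrightarrow> v \<noteq> 0\<^sub>v d \<Longrightarrow> 0 < v \<bullet> (Q *\<^sub>v v)"
    using assms by (auto simp: pos_def_def)
  have det: "det Q > 0" using assms by (rule pos_def_det_pos)
  then have d0: "det Q \<noteq> 0" by simp
  note I = mat_inv_correct[OF Q d0]
  have tB: "transpose_mat (mat_inv Q) = mat_inv Q"
  proof -
    \<comment> \<open>By symmetry of \<open>Q\<close> the transposed inverse is again a left
      inverse, hence equal to the inverse.\<close>
    have 1: "transpose_mat (mat_inv Q) * Q = 1\<^sub>m d"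
      using I(2) transpose_mult[OF Q I(1)] t by simp
    have "transpose_mat (mat_inv Q) = transpose_mat (mat_inv Q) * (Q * mat_inv Q)"
      using I by simp
    also have "\<dots> = (transpose_mat (mat_inv Q) * Q) * mat_inv Q"
      using I(1) Q by (simp add: assoc_mult_mat)
    finally show ?thesis using 1 I(1) by simp
  qed
  have "0 < v \<bullet> (mat_inv Q *\<^sub>v v)" if v: "v \<in> carrier_vec d" "v \<noteq> 0\<^sub>v d" for v
  proof -
    let ?w = "mat_inv Q *\<^sub>v v"
    have w: "?w \<in> carrier_vec d" using I(1) v by simp
    have vw: "Q *\<^sub>v ?w = v"
      using I Q v by (simp flip: assoc_mult_mat_vec)
    have "?w \<noteq> 0\<^sub>v d" 
    proof
      assume "?w = 0\<^sub>v d"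
      then have "v = Q *\<^sub>v 0\<^sub>v d" using vw by simp
      also have "\<dots> = 0\<^sub>v d" using Q by (intro eq_vecI) auto
      finally show False using v(2) by simp
    qed
    then have "0 < ?w \<bullet> (Q *\<^sub>v ?w)" using p w by blast
    also have "\<dots> = v \<bullet> ?w" using vw w v by (simp add: comm_scalar_prod)
    finally show ?thesis .
  qed
  then show "pos_def d (mat_inv Q)" using I(1) tB by (auto simp: pos_def_def)
  have "det Q * det (mat_inv Q) = 1" using I det_mult[OF Q I(1)] by simp
  then show "det (mat_inv Q) = 1 / det Q" using d0 by (simp add: field_simps)
qed

lemma quad_form_smult:
  "A \<in> carrier_mat d d \<Longrightarrow> quad_form d (c \<cdot>\<^sub>m A) y = c * quad_form d A y"
  by (auto simp: quad_form_def sum_distrib_left mult_ac intro!: sum.cong)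

lemma pos_def_smult:
  assumes "pos_def d A" "0 < c"
  shows "pos_def d (c \<cdot>\<^sub>m A)"
proof -
  have A: "A \<in> carrier_mat d d" using assms by (simp add: pos_def_def)
  then show ?thesis using assms by (auto simp: pos_def_iff_quad_form quad_form_smult)
qed

section \<open>Mass and second moment of a normal density\<close>

lemma mvn_density_quad_form:
  assumes "pos_def d Q" "m \<in> carrier_vec d"
  shows "mvn_density m Q (vec d y) =
    exp (- quad_form d (mat_inv Q) (\<lambda>i. y i - m $ i) / 2) / sqrt ((2 * pi) ^ d * det Q)"
proof -
  have "vec d y - m = vec d (\<lambda>i. y i - m $ i)" using assms(2) by auto
  moreover have "mat_inv Q \<in> carrier_mat d d" using pos_def_mat_inv(1)[OF assms(1)] by (simp add: pos_def_def)
  ultimately show ?thesis using assms(2) by (simp add: mvn_density_def scalar_prod_mult_mat_vec)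
qed

lemma mvn_density_pos:
  "pos_def d Q \<Longrightarrow> m \<in> carrier_vec d \<Longrightarrow> 0 < mvn_density m Q (vec d y)"
  by (simp add: mvn_density_quad_form pos_def_det_pos)

lemma measurable_mvn_density:
  assumes "pos_def d Q" "m \<in> carrier_vec d"
  shows "(\<lambda>y. mvn_density m Q (vec d y)) \<in> borel_measurable (\<Pi>\<^sub>M i\<in>{..<d}. lborel)"
  unfolding mvn_density_quad_form[OF assms] by measurable

lemma nn_integral_mvn_density:
  assumes Q: "pos_def d Q" and m: "m \<in> carrier_vec d"
  shows "(\<integral>\<^sup>+y. ennreal (mvn_density m Q (vec d y)) \<partial>(\<Pi>\<^sub>M i\<in>{..<d}. lborel)) = 1"
proof -
  let ?c = "sqrt ((2 * pi) ^ d * det Q)"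
  have c: "0 < ?c" using pos_def_det_pos[OF Q] by simp
  have N: "(\<integral>\<^sup>+y. ennreal (exp (- quad_form d (mat_inv Q) (\<lambda>i. y i - m $ i) / 2))
      \<partial>(\<Pi>\<^sub>M i\<in>{..<d}. lborel)) = ennreal ?c"
    using nn_integral_exp_quad_form[OF pos_def_mat_inv(1)[OF Q], of "\<lambda>i. m $ i"]
      pos_def_mat_inv(2)[OF Q] by simp
  have "(\<integral>\<^sup>+y. ennreal (mvn_density m Q (vec d y)) \<partial>(\<Pi>\<^sub>M i\<in>{..<d}. lborel)) =
     (\<integral>\<^sup>+y. ennreal (exp (- quad_form d (mat_inv Q) (\<lambda>i. y i - m $ i) / 2)) * ennreal (1 / ?c)
       \<partial>(\<Pi>\<^sub>M i\<in>{..<d}. lborel))"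
    unfolding mvn_density_quad_form[OF Q m] using c pos_def_det_pos[OF Q] by (simp add: ennreal_mult[symmetric])
  also have "\<dots> = ennreal ?c * ennreal (1 / ?c)"
    unfolding N[symmetric] by (rule nn_integral_multc) measurable
  also have "\<dots> = 1" using c pos_def_det_pos[OF Q] by (simp add: ennreal_mult[symmetric])
  finally show ?thesis .
qed

text \<open>Half of the Gaussian exponent absorbs the polynomial: by coercivity
  \<open>1 + |y|^2\<close> is at most a constant times \<open>exp (q y / 4)\<close>. The remaining
  \<open>exp (- q y / 4)\<close> is a Gaussian for the halved matrix \<open>B\<close>.\<close>

lemma integrable_mvn_density_second_moment:
  assumes Q: "pos_def d Q" and m: "m \<in> carrier_vec d"
  shows "integrable (\<Pi>\<^sub>M i\<in>{..<d}. lborel)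
    (\<lambda>y. (1 + (\<Sum>i<d. (y i)\<^sup>2)) * mvn_density m Q (vec d y))"
proof -
  define B where "B = mat_inv Q"
  define q where "q y = quad_form d B (\<lambda>i. y i - m $ i)" for y
  have B: "pos_def d B" unfolding B_def using Q by (rule pos_def_mat_inv)
  then have Bc: "B \<in> carrier_mat d d" by (simp add: pos_def_def)
  obtain K where K: "K > 0" "\<And>y. (\<Sum>i<d. (y i)\<^sup>2) \<le> K * quad_form d B y"
    using pos_def_coercive[OF B] by blast
  define c where "c = 1 / sqrt ((2 * pi) ^ d * det Q)"
  have c: "c \<ge> 0" unfolding c_def using pos_def_det_pos[OF Q] by simp
  \<comment> \<open>The term \<open>8 * K\<close> comes from writing the coercivity bound
    \<open>2 * K * q\<close> as \<open>8 * K * (q / 4)\<close> and using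
    \<open>q / 4 \<le> exp (q / 4)\<close>; the factor \<open>c\<close> normalises the
    density.\<close>
  define C where "C = (1 + 2 * (\<Sum>i<d. (m $ i)\<^sup>2) + 8 * K) * c"
  have q0: "0 \<le> q y" for y
  proof -
    have "0 \<le> K * q y" unfolding q_def using K(2) by (meson order_trans sum_nonneg zero_le_power2)
    then show ?thesis using K(1) by (simp add: zero_le_mult_iff)
  qed
  have meas: "q \<in> borel_measurable (\<Pi>\<^sub>M i\<in>{..<d}. lborel)" unfolding q_def by measurable
  have int: "integrable (\<Pi>\<^sub>M i\<in>{..<d}. lborel) (\<lambda>y. C * exp (- q y / 4))"
  proof (rule integrable_mult_right, rule integrableI_nonneg)
    have "(\<integral>\<^sup>+y. ennreal (exp (- q y / 4)) \<partial>(\<Pi>\<^sub>M i\<in>{..<d}. lborel))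
      = ennreal (sqrt ((2 * pi) ^ d / det ((1/2) \<cdot>\<^sub>m B)))"
      using nn_integral_exp_quad_form[OF pos_def_smult[OF B, of "1/2"], of "\<lambda>i. m $ i"]
      by (simp add: quad_form_smult[OF Bc] q_def)
    then show "(\<integral>\<^sup>+y. ennreal (exp (- q y / 4)) \<partial>(\<Pi>\<^sub>M i\<in>{..<d}. lborel)) < \<infinity>" by simp
  qed (use meas in auto)
  show ?thesis
  proof (rule Bochner_Integration.integrable_bound[OF int])
    show "(\<lambda>y. (1 + (\<Sum>i<d. (y i)\<^sup>2)) * mvn_density m Q (vec d y)) \<in> borel_measurable (\<Pi>\<^sub>M i\<in>{..<d}. lborel)"
      using measurable_mvn_density[OF Q m] by measurable
    show "AE y in (\<Pi>\<^sub>M i\<in>{..<d}. lborel). norm ((1 + (\<Sum>i<d. (y i)\<^sup>2)) * mvn_density m Q (vec d y))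
       \<le> norm (C * exp (- q y / 4))"
    proof (rule AE_I2)
      fix y
      have "(y i)\<^sup>2 \<le> 2 * (m $ i)\<^sup>2 + 2 * (y i - m $ i)\<^sup>2" for i
        using zero_le_power2[of "y i - 2 * m $ i"] by (simp add: power2_eq_square algebra_simps)
      then have "(\<Sum>i<d. (y i)\<^sup>2) \<le> (\<Sum>i<d. 2 * (m $ i)\<^sup>2 + 2 * (y i - m $ i)\<^sup>2)"
        by (intro sum_mono)
      also have "\<dots> = 2 * (\<Sum>i<d. (m $ i)\<^sup>2) + 2 * (\<Sum>i<d. (y i - m $ i)\<^sup>2)"
        by (simp add: sum.distrib sum_distrib_left)
      also have "\<dots> \<le> 2 * (\<Sum>i<d. (m $ i)\<^sup>2) + 2 * (K * q y)"
        using K(2)[of "\<lambda>i. y i - m $ i"] by (simp add: q_def)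
      finally have 1: "1 + (\<Sum>i<d. (y i)\<^sup>2) \<le> (1 + 2 * (\<Sum>i<d. (m $ i)\<^sup>2)) * 1 + 8 * K * (q y / 4)" by simp
      have e: "q y / 4 \<le> exp (q y / 4)" "1 \<le> exp (q y / 4)"
        using exp_ge_add_one_self[of "q y / 4"] q0[of y] by linarith+
      have "(1 + 2 * (\<Sum>i<d. (m $ i)\<^sup>2)) * 1 + 8 * K * (q y / 4)
          \<le> (1 + 2 * (\<Sum>i<d. (m $ i)\<^sup>2)) * exp (q y / 4) + 8 * K * exp (q y / 4)"
        using K(1) e by (intro add_mono mult_left_mono) (auto simp: sum_nonneg add_nonneg_nonneg)
      with 1 have 2: "1 + (\<Sum>i<d. (y i)\<^sup>2) \<le> (1 + 2 * (\<Sum>i<d. (m $ i)\<^sup>2) + 8 * K) * exp (q y / 4)"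
        by (simp add: algebra_simps)
      have "(1 + (\<Sum>i<d. (y i)\<^sup>2)) * mvn_density m Q (vec d y)
        = (1 + (\<Sum>i<d. (y i)\<^sup>2)) * (c * exp (- q y / 2))"
        by (simp add: mvn_density_quad_form[OF Q m] q_def B_def c_def)
      also have "\<dots> \<le> ((1 + 2 * (\<Sum>i<d. (m $ i)\<^sup>2) + 8 * K) * exp (q y / 4)) * (c * exp (- q y / 2))"
        using 2 c by (intro mult_right_mono) auto
      also have "\<dots> = C * (exp (q y / 4) * exp (- q y / 2))" by (simp add: C_def)
      also have "exp (q y / 4) * exp (- q y / 2) = exp (- q y / 4)" by (simp add: exp_add[symmetric])
      finally show "norm ((1 + (\<Sum>i<d. (y i)\<^sup>2)) * mvn_density m Q (vec d y)) \<le> norm (C * exp (- q y / 4))"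
        using less_imp_le[OF mvn_density_pos[OF Q m, of y]]
        by (simp add: sum_nonneg)
    qed
  qed
qed

section \<open>Filter recursion and density of the information vector\<close>

definition prob_vec :: "nat \<Rightarrow> real vec \<Rightarrow> bool" where
  "prob_vec n p \<longleftrightarrow> p \<in> carrier_vec n \<and> (\<forall>i<n. 0 \<le> p $ i) \<and> (\<Sum>i<n. p $ i) = 1"

lemma prob_vec_le_1: "prob_vec n p \<Longrightarrow> i < n \<Longrightarrow> p $ i \<le> 1"
  unfolding prob_vec_def using member_le_sum[of i "{..<n}" "($) p"] by auto

text \<open>Individual weights may vanish, but total mass one forces a positive weight, and the
  other terms are nonnegative.\<close>

lemma prob_vec_sum_pos:
  assumes p: "prob_vec n p" and f: "\<And>i. i < n \<Longrightarrow> 0 < f i"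
  shows "0 < (\<Sum>i<n. p $ i * f i)"
proof -
  have "\<exists>i<n. p $ i \<noteq> 0"
  proof (rule ccontr)
    assume "\<not> ?thesis"
    then have "(\<Sum>i<n. p $ i) = 0" by simp
    then show False using p by (simp add: prob_vec_def)
  qed
  then obtain i where i: "i < n" "p $ i > 0" using p by (auto simp: prob_vec_def less_le)
  have "0 \<le> p $ j * f j" if "j < n" for j
    using that p less_imp_le[OF f[OF that]] by (simp add: prob_vec_def)
  then have "p $ i * f i \<le> (\<Sum>i<n. p $ i * f i)"
    using i by (intro member_le_sum) auto
  moreover have "0 < p $ i * f i" using i f by simp
  ultimately show ?thesis by linarith
qed

section \<open>Observation densities and the predictive mixture\<close>

locale hmm_model =
  fixes M :: "'u hmm"
  assumes valid: "valid_hmm M"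
begin

abbreviation "n \<equiv> nst M"

lemma init_prob_vec: "prob_vec n (init_dist M)"
  using valid by (simp add: valid_hmm_def prob_vec_def)

lemma trans_mat_carrier: "trans_mat M \<in> carrier_mat n n"
  and trans_mat_nonneg: "i < n \<Longrightarrow> j < n \<Longrightarrow> 0 \<le> trans_mat M $$ (j, i)"
  and trans_mat_sum: "i < n \<Longrightarrow> (\<Sum>j<n. trans_mat M $$ (j, i)) = 1"
  and finite_ctrls: "finite (ctrls M)"
  and ctrl0: "ctrl0 M \<in> ctrls M"
  and omean_carrier: "u \<in> ctrls M \<Longrightarrow> i < n \<Longrightarrow> omean M u i \<in> carrier_vec (odim M u)"
  and ocov_pos_def: "u \<in> ctrls M \<Longrightarrow> i < n \<Longrightarrow> pos_def (odim M u) (ocov M u i)"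
  using valid by (auto simp: valid_hmm_def)

lemma obs_dens_pos: "u \<in> ctrls M \<Longrightarrow> i < n \<Longrightarrow> 0 < obs_dens M u i y"
  unfolding obs_dens_def obs_vec_def by (intro mvn_density_pos ocov_pos_def omean_carrier)

lemma measurable_obs_dens:
  "u \<in> ctrls M \<Longrightarrow> i < n \<Longrightarrow> obs_dens M u i \<in> borel_measurable (obs_space M u)"
  unfolding obs_dens_def[abs_def] obs_vec_def obs_space_def
  by (intro measurable_mvn_density ocov_pos_def omean_carrier)

text \<open>A weight for measuring growth in the observation: the square matches the quadratic stage
  cost, and the summand 1 lets the weight also dominate bounded functions.\<close>

definition obs_size :: "'u \<Rightarrow> (nat \<Rightarrow> real) \<Rightarrow> real" where
  "obs_size u y = 1 + (\<Sum>j<odim M u. (y j)\<^sup>2)"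

lemma obs_size_ge_1: "1 \<le> obs_size u y"
  by (simp add: obs_size_def sum_nonneg)

lemma integrable_obs_size:
  "u \<in> ctrls M \<Longrightarrow> i < n \<Longrightarrow> integrable (obs_space M u) (\<lambda>y. obs_size u y * obs_dens M u i y)"
  unfolding obs_dens_def[abs_def] obs_vec_def obs_space_def obs_size_def
  by (intro integrable_mvn_density_second_moment ocov_pos_def omean_carrier)

lemma obs_dens_integral:
  assumes "u \<in> ctrls M" "i < n"
  shows "integrable (obs_space M u) (obs_dens M u i)" "(\<integral>y. obs_dens M u i y \<partial>obs_space M u) = 1"
proof -
  have N: "(\<integral>\<^sup>+y. ennreal (obs_dens M u i y) \<partial>obs_space M u) = ennreal 1"
    unfolding obs_dens_def obs_vec_def obs_space_def
    using nn_integral_mvn_density[OF ocov_pos_def omean_carrier] assms by simp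
  have nn: "0 \<le> obs_dens M u i y" for y using obs_dens_pos[OF assms, of y] by simp
  show "integrable (obs_space M u) (obs_dens M u i)"
    using N nn by (intro integrableI_nonneg measurable_obs_dens assms) auto
  show "(\<integral>y. obs_dens M u i y \<partial>obs_space M u) = 1"
    using N nn by (subst integral_eq_nn_integral) (auto intro: measurable_obs_dens assms)
qed

text \<open>The same function is the density of the next observation and the normalising constant of
  the Bayes update.\<close>

definition mix_dens :: "real vec \<Rightarrow> 'u \<Rightarrow> (nat \<Rightarrow> real) \<Rightarrow> real" where
  "mix_dens p u y = (\<Sum>i<n. p $ i * obs_dens M u i y)"

lemma mix_dens_pos: "prob_vec n p \<Longrightarrow> u \<in> ctrls M \<Longrightarrow> 0 < mix_dens p u y"
  unfolding mix_dens_def by (intro prob_vec_sum_pos obs_dens_pos)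

lemma measurable_mix_dens: "u \<in> ctrls M \<Longrightarrow> mix_dens p u \<in> borel_measurable (obs_space M u)"
  unfolding mix_dens_def[abs_def]
  by (intro borel_measurable_sum borel_measurable_times measurable_obs_dens) auto

lemma mix_dens_integral:
  assumes "prob_vec n p" "u \<in> ctrls M"
  shows "integrable (obs_space M u) (mix_dens p u)" "(\<integral>y. mix_dens p u y \<partial>obs_space M u) = 1"
proof -
  show "integrable (obs_space M u) (mix_dens p u)" unfolding mix_dens_def[abs_def]
    by (intro Bochner_Integration.integrable_sum integrable_mult_right obs_dens_integral assms) auto
  show "(\<integral>y. mix_dens p u y \<partial>obs_space M u) = 1" unfolding mix_dens_def
    by (subst Bochner_Integration.integral_sum)
      (use assms in \<open>auto intro: obs_dens_integral simp: obs_dens_integral prob_vec_def\<close>)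
qed

text \<open>A sum over all controls and states in place of a maximum; since the moments are
  nonnegative, it dominates each of them.\<close>

definition size_bound :: real where
  "size_bound = (\<Sum>u\<in>ctrls M. \<Sum>i<n. \<integral>y. obs_size u y * obs_dens M u i y \<partial>obs_space M u)"

lemma integral_size_nonneg:
  "u \<in> ctrls M \<Longrightarrow> i < n \<Longrightarrow> 0 \<le> (\<integral>y. obs_size u y * obs_dens M u i y \<partial>obs_space M u)"
proof (intro Bochner_Integration.integral_nonneg mult_nonneg_nonneg)
  fix y assume "u \<in> ctrls M" "i < n"
  then show "0 \<le> obs_size u y" "0 \<le> obs_dens M u i y"
    using obs_size_ge_1[of u y] obs_dens_pos[of u i y] by auto
qed

text \<open>Replacing every weight of the mixture by 1 removes the predictor from the bound.\<close>

lemma mix_dens_obs_size: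
  assumes p: "prob_vec n p" and u: "u \<in> ctrls M"
  shows "integrable (obs_space M u) (\<lambda>y. obs_size u y * mix_dens p u y)"
    "(\<integral>y. obs_size u y * mix_dens p u y \<partial>obs_space M u) \<le> size_bound"
proof -
  have eq: "obs_size u y * mix_dens p u y = (\<Sum>i<n. p $ i * (obs_size u y * obs_dens M u i y))" for y
    by (simp add: mix_dens_def sum_distrib_left mult_ac)
  show "integrable (obs_space M u) (\<lambda>y. obs_size u y * mix_dens p u y)" unfolding eq
    by (intro Bochner_Integration.integrable_sum integrable_mult_right integrable_obs_size u) auto
  let ?I = "\<lambda>u i. \<integral>y. obs_size u y * obs_dens M u i y \<partial>obs_space M u"
  have "(\<integral>y. obs_size u y * mix_dens p u y \<partial>obs_space M u) = (\<Sum>i<n. p $ i * ?I u i)"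
    unfolding eq
    by (subst Bochner_Integration.integral_sum) (auto intro!: integrable_obs_size u)
  also have "\<dots> \<le> (\<Sum>i<n. 1 * ?I u i)"
    by (intro sum_mono mult_right_mono) (use p u prob_vec_le_1 integral_size_nonneg in auto)
  also have "\<dots> \<le> size_bound" unfolding size_bound_def
    using finite_ctrls u integral_size_nonneg
    by (simp only: mult_1) (intro member_le_sum[of u "ctrls M" "\<lambda>u. \<Sum>i<n. ?I u i"] sum_nonneg, auto)
  finally show "(\<integral>y. obs_size u y * mix_dens p u y \<partial>obs_space M u) \<le> size_bound" .
qed

section \<open>The Bayes update and the joint density of states and observations\<close>

lemma predictor_Suc_index:
  assumes "predictor M h k \<in> carrier_vec n" "j < n"
  shows "predictor M h (Suc k) $ j =
    (\<Sum>i<n. trans_mat M $$ (j, i) * (predictor M h k $ i * obs_dens M (prev_ctrl M (snd h) k) i (fst h k)))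
      / mix_dens (predictor M h k) (prev_ctrl M (snd h) k) (fst h k)"
proof -
  define v where "v = likelihood_mat M (prev_ctrl M (snd h) k) (fst h k) *\<^sub>v predictor M h k"
  have v: "v \<in> carrier_vec n"
    by (rule carrier_vecI) (simp add: v_def likelihood_mat_def mat_diag_def)
  have vi: "v $ i = predictor M h k $ i * obs_dens M (prev_ctrl M (snd h) k) i (fst h k)"
    if "i < n" for i
    using assms(1) that unfolding v_def
    by (simp add: likelihood_mat_def mat_diag_def scalar_prod_def if_distrib[of "\<lambda>x. x * _"] cong: if_cong)
  have "predictor M h (Suc k) = (1 / (vec n (\<lambda>_. 1) \<bullet> v)) \<cdot>\<^sub>v (trans_mat M *\<^sub>v v)"
    by (simp add: Let_def v_def)
  then show ?thesis
    using assms(2) trans_mat_carrier v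
    by (simp add: mix_dens_def scalar_prod_def lessThan_atLeast0 vi del: predictor.simps)
qed

text \<open>Only the controls are restricted: every observation has positive likelihood, so the
  normaliser never vanishes. Because the columns of the transition matrix sum to one, exchanging the
  sums makes the numerators add up to that normaliser.\<close>

lemma predictor_prob_vec:
  "(\<And>s. s < k \<Longrightarrow> prev_ctrl M (snd h) s \<in> ctrls M) \<Longrightarrow> prob_vec n (predictor M h k)"
proof (induction k)
  case 0
  then show ?case by (simp add: init_prob_vec)
next
  case (Suc k)
  let ?p = "predictor M h k" and ?u = "prev_ctrl M (snd h) k" and ?y = "fst h k"
  have p: "prob_vec n ?p" and u: "?u \<in> ctrls M" using Suc by auto
  then have pc: "?p \<in> carrier_vec n" by (simp add: prob_vec_def)
  note D = mix_dens_pos[OF p u, of ?y]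
  have "predictor M h (Suc k) \<in> carrier_vec n"
    unfolding predictor.simps Let_def
    by (rule carrier_vecI) (simp only: index_smult_vec dim_mult_mat_vec carrier_matD(1)[OF trans_mat_carrier])
  moreover have "0 \<le> predictor M h (Suc k) $ j" if "j < n" for j
    unfolding predictor_Suc_index[OF pc that]
  proof (intro divide_nonneg_pos sum_nonneg mult_nonneg_nonneg D)
    fix i assume "i \<in> {..<n}"
    then show "0 \<le> trans_mat M $$ (j, i)" "0 \<le> ?p $ i" "0 \<le> obs_dens M ?u i ?y"
      using that p obs_dens_pos[OF u, of i ?y] by (auto simp: prob_vec_def trans_mat_nonneg)
  qed
  moreover have "(\<Sum>j<n. predictor M h (Suc k) $ j) = 1"
  proof -
    have "(\<Sum>j<n. predictor M h (Suc k) $ j) =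
      (\<Sum>j<n. \<Sum>i<n. trans_mat M $$ (j, i) * (?p $ i * obs_dens M ?u i ?y)) / mix_dens ?p ?u ?y"
      unfolding sum_divide_distrib
      by (intro sum.cong refl) (simp add: predictor_Suc_index[OF pc] sum_divide_distrib del: predictor.simps)
    also have "(\<Sum>j<n. \<Sum>i<n. trans_mat M $$ (j, i) * (?p $ i * obs_dens M ?u i ?y)) =
      (\<Sum>i<n. \<Sum>j<n. trans_mat M $$ (j, i) * (?p $ i * obs_dens M ?u i ?y))"
      by (rule sum.swap)
    also have "\<dots> = (\<Sum>i<n. (\<Sum>j<n. trans_mat M $$ (j, i)) * (?p $ i * obs_dens M ?u i ?y))"
      by (simp add: sum_distrib_right)
    also have "\<dots> = mix_dens ?p ?u ?y" by (simp add: trans_mat_sum mix_dens_def)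
    finally show ?thesis using D by simp
  qed
  ultimately show ?case by (simp add: prob_vec_def del: predictor.simps)
qed

text \<open>A path is split into its final state \<open>j\<close> and the shorter path. In the inner
  sum the transition probability into \<open>j\<close> is itself a weight depending on the last
  state of the shorter path, so a statement about all weights can be iterated.\<close>

lemma path_sum_Suc:
  "(\<Sum>xs \<in> {..Suc k} \<rightarrow>\<^sub>E {..<n}. path_dens M (Suc k) xs h * g (xs (Suc k))) =
   (\<Sum>j<n. obs_dens M (prev_ctrl M (snd h) (Suc k)) j (fst h (Suc k)) * g j *
      (\<Sum>xs \<in> {..k} \<rightarrow>\<^sub>E {..<n}. path_dens M k xs h * trans_mat M $$ (j, xs k)))"
proof -
  have "(\<Sum>xs \<in> {..Suc k} \<rightarrow>\<^sub>E {..<n}. path_dens M (Suc k) xs h * g (xs (Suc k))) =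
    (\<Sum>(j, xs) \<in> {..<n} \<times> ({..k} \<rightarrow>\<^sub>E {..<n}).
       path_dens M (Suc k) (xs(Suc k := j)) h * g ((xs(Suc k := j)) (Suc k)))"
    unfolding atMost_Suc PiE_insert_eq
    by (subst sum.reindex) (auto intro!: inj_combinator simp: case_prod_beta comp_def)
  also have "\<dots> = (\<Sum>(j, xs) \<in> {..<n} \<times> ({..k} \<rightarrow>\<^sub>E {..<n}).
      obs_dens M (prev_ctrl M (snd h) (Suc k)) j (fst h (Suc k)) * g j *
        (path_dens M k xs h * trans_mat M $$ (j, xs k)))"
    by (intro sum.cong refl) (auto simp: path_dens_def)
  finally show ?thesis by (simp add: sum.cartesian_product sum_distrib_left)
qed

text \<open>Weighting paths by a function of the final state makes the induction for the filter recursion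
  go through.\<close>

lemma path_sum_step:
  assumes u: "\<And>s. s \<le> k \<Longrightarrow> prev_ctrl M (snd h) s \<in> ctrls M"
    and c: "\<And>g. (\<Sum>xs \<in> {..k} \<rightarrow>\<^sub>E {..<n}. path_dens M k xs h * g (xs k)) =
      c * (\<Sum>i<n. predictor M h k $ i * obs_dens M (prev_ctrl M (snd h) k) i (fst h k) * g i)"
  shows "info_dens M k h = c * mix_dens (predictor M h k) (prev_ctrl M (snd h) k) (fst h k)"
    and "(\<Sum>xs \<in> {..Suc k} \<rightarrow>\<^sub>E {..<n}. path_dens M (Suc k) xs h * g (xs (Suc k))) =
      info_dens M k h * (\<Sum>i<n. predictor M h (Suc k) $ i
        * obs_dens M (prev_ctrl M (snd h) (Suc k)) i (fst h (Suc k)) * g i)"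
proof -
  let ?p = "predictor M h k" and ?u = "prev_ctrl M (snd h) k" and ?y = "fst h k"
  have p: "prob_vec n ?p" using u by (intro predictor_prob_vec) auto
  then have pc: "?p \<in> carrier_vec n" by (simp add: prob_vec_def)
  have D: "0 < mix_dens ?p ?u ?y" using p u by (intro mix_dens_pos) auto
  show 1: "info_dens M k h = c * mix_dens ?p ?u ?y"
    using c[of "\<lambda>_. 1"] by (simp add: info_dens_def mix_dens_def)
  \<comment> \<open>With the probability of moving to \<open>j\<close> as weight, the hypothesis
    yields the numerator of the Bayes update; its denominator is absorbed by the density of the
    observations.\<close>
  have S: "(\<Sum>xs \<in> {..k} \<rightarrow>\<^sub>E {..<n}. path_dens M k xs h * trans_mat M $$ (j, xs k)) =
      info_dens M k h * predictor M h (Suc k) $ j" if "j < n" for j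
    using c[of "\<lambda>i. trans_mat M $$ (j, i)"] D unfolding 1 predictor_Suc_index[OF pc that]
    by (simp add: mult_ac)
  then show "(\<Sum>xs \<in> {..Suc k} \<rightarrow>\<^sub>E {..<n}. path_dens M (Suc k) xs h * g (xs (Suc k))) =
      info_dens M k h * (\<Sum>i<n. predictor M h (Suc k) $ i
        * obs_dens M (prev_ctrl M (snd h) (Suc k)) i (fst h (Suc k)) * g i)"
    unfolding path_sum_Suc
    by (subst sum_distrib_left, intro sum.cong refl) (simp only: S lessThan_iff mult_ac)
qed

lemma path_sum_0:
  "(\<Sum>xs \<in> {..0} \<rightarrow>\<^sub>E {..<n}. path_dens M 0 xs h * g (xs 0)) =
    (\<Sum>i<n. predictor M h 0 $ i * obs_dens M (prev_ctrl M (snd h) 0) i (fst h 0) * g i)"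
proof -
  have "({..0} \<rightarrow>\<^sub>E {..<n}) = (\<lambda>i. (\<lambda>_::nat. undefined)(0 := i)) ` {..<n}"
    using PiE_insert_eq[of "0::nat" "{}" "\<lambda>_. {..<n}"] by (auto simp: image_iff)
  moreover have "inj_on (\<lambda>i. (\<lambda>_::nat. undefined)(0 := i)) {..<n}"
    by (intro inj_onI) (metis fun_upd_same)
  ultimately show ?thesis by (simp add: sum.reindex path_dens_def)
qed

text \<open>This is the correctness of the filter: the joint density of the current state and the
  observations is the density of the past times predictor times likelihood. The constant
  \<open>c\<close> is 1 for \<open>k = 0\<close> and otherwise the density of the preceding
  information vector.\<close>

lemma path_sum_eq:
  assumes "\<And>s. s \<le> k \<Longrightarrow> prev_ctrl M (snd h) s \<in> ctrls M"
  shows "\<exists>c>0. \<forall>g. (\<Sum>xs \<in> {..k} \<rightarrow>\<^sub>E {..<n}. path_dens M k xs h * g (xs k)) =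
      c * (\<Sum>i<n. predictor M h k $ i * obs_dens M (prev_ctrl M (snd h) k) i (fst h k) * g i)"
  using assms
proof (induction k)
  case 0
  then show ?case using path_sum_0 by (intro exI[of _ 1]) auto
next
  case (Suc k)
  then have u: "\<And>s. s \<le> k \<Longrightarrow> prev_ctrl M (snd h) s \<in> ctrls M" by simp
  obtain c where c: "c > 0" "\<And>g. (\<Sum>xs \<in> {..k} \<rightarrow>\<^sub>E {..<n}. path_dens M k xs h * g (xs k)) =
      c * (\<Sum>i<n. predictor M h k $ i * obs_dens M (prev_ctrl M (snd h) k) i (fst h k) * g i)"
    using Suc.IH[OF u] by blast
  have "0 < mix_dens (predictor M h k) (prev_ctrl M (snd h) k) (fst h k)"
    using u by (intro mix_dens_pos predictor_prob_vec) auto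
  then have "info_dens M k h > 0" using path_sum_step(1)[OF u c(2)] c(1) by simp
  then show ?case using path_sum_step(2)[OF u c(2)] by blast
qed

lemma info_dens_pos:
  assumes "\<And>s. s \<le> k \<Longrightarrow> prev_ctrl M (snd h) s \<in> ctrls M"
  shows "0 < info_dens M k h"
proof -
  obtain c where c: "c > 0" "\<And>g. (\<Sum>xs \<in> {..k} \<rightarrow>\<^sub>E {..<n}. path_dens M k xs h * g (xs k)) =
      c * (\<Sum>i<n. predictor M h k $ i * obs_dens M (prev_ctrl M (snd h) k) i (fst h k) * g i)"
    using path_sum_eq[of k h] assms by blast
  have "0 < mix_dens (predictor M h k) (prev_ctrl M (snd h) k) (fst h k)"
    using assms by (intro mix_dens_pos predictor_prob_vec) auto
  then show ?thesis using path_sum_step(1)[OF assms c(2)] c(1) by simp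
qed

lemma info_dens_Suc:
  assumes "\<And>s. s \<le> k \<Longrightarrow> prev_ctrl M (snd h) s \<in> ctrls M"
  shows "info_dens M (Suc k) h = info_dens M k h *
    mix_dens (predictor M h (Suc k)) (prev_ctrl M (snd h) (Suc k)) (fst h (Suc k))"
proof -
  obtain c where c: "\<And>g. (\<Sum>xs \<in> {..k} \<rightarrow>\<^sub>E {..<n}. path_dens M k xs h * g (xs k)) =
      c * (\<Sum>i<n. predictor M h k $ i * obs_dens M (prev_ctrl M (snd h) k) i (fst h k) * g i)"
    using path_sum_eq[of k h] assms by blast
  show ?thesis
    using path_sum_step(2)[OF assms c, where g = "\<lambda>_. 1"] by (simp add: info_dens_def mix_dens_def del: predictor.simps)
qed

end

section \<open>Growth and measurability of the stage cost\<close>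

text \<open>The \<open>j\<close>-th column \<open>y\<close> of the inverse solves
  \<open>A y = e_j\<close>, so the form at \<open>y\<close> equals \<open>y j\<close>. Coercivity
  then gives \<open>(y k)^2 \<le> K * y j\<close> for all \<open>k\<close>; the case
  \<open>k = j\<close> bounds \<open>y j\<close> by \<open>K\<close>, and this bounds the other
  entries.\<close>

lemma mat_inv_entry_le:
  assumes A: "pos_def d A" and K: "\<And>y. (\<Sum>i<d. (y i)\<^sup>2) \<le> K * quad_form d A y"
    and i: "i < d" and j: "j < d"
  shows "\<bar>mat_inv A $$ (i, j)\<bar> \<le> K"
proof -
  have Ac: "A \<in> carrier_mat d d" using A by (simp add: pos_def_def)
  have d0: "det A \<noteq> 0" using pos_def_det_pos[OF A] by simp
  note I = mat_inv_correct[OF Ac d0]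
  define y where "y k = mat_inv A $$ (k, j)" for k
  have "(\<Sum>l<d. A $$ (k, l) * y l) = (if k = j then 1 else 0)" if "k < d" for k
  proof -
    have "(A * mat_inv A) $$ (k, j) = (\<Sum>l<d. A $$ (k, l) * y l)"
      using Ac I(1) that j by (simp add: scalar_prod_def y_def lessThan_atLeast0)
    then show ?thesis using I(2) that j by simp
  qed
  then have "(\<Sum>k<d. y k * (\<Sum>l<d. A $$ (k, l) * y l)) = (\<Sum>k<d. y k * (if k = j then 1 else 0))"
    by simp
  also have "\<dots> = y j" using j by (simp add: if_distrib[of "\<lambda>x. _ * x"] cong: if_cong)
  also have "(\<Sum>k<d. y k * (\<Sum>l<d. A $$ (k, l) * y l)) = quad_form d A y"
    by (simp add: quad_form_def sum_distrib_left mult_ac)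
  finally have q: "quad_form d A y = y j" .
  have le: "(y k)\<^sup>2 \<le> K * y j" if "k < d" for k
    using K[of y] q member_le_sum[of k "{..<d}" "\<lambda>i. (y i)\<^sup>2"] that by auto
  have "y j \<noteq> 0"
  proof
    assume "y j = 0"
    then have "y k = 0" if "k < d" for k using le[OF that] by simp
    then have "(\<Sum>l<d. A $$ (j, l) * y l) = 0" by simp
    with \<open>\<And>k. k < d \<Longrightarrow> (\<Sum>l<d. A $$ (k, l) * y l) = (if k = j then 1 else 0)\<close>[OF j]
    show False by simp
  qed
  moreover have "0 \<le> y j"
  proof (cases "y j = 0")
    case False
    with j have "\<exists>i<d. y i \<noteq> 0" by blast
    with A have "0 < quad_form d A y" by (simp add: pos_def_iff_quad_form)
    with q show ?thesis by simp
  qed simp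
  ultimately have yj: "0 < y j" by simp
  have "y j * y j \<le> K * y j" using le[OF j] by (simp add: power2_eq_square)
  then have jK: "y j \<le> K" using yj by simp
  have "(y i)\<^sup>2 \<le> K * K" using le[OF i] jK yj by (meson mult_left_mono order_trans less_imp_le)
  then have "\<bar>y i\<bar> \<le> K" using abs_le_square_iff[of "y i" K] jK yj by (simp add: power2_eq_square)
  then show ?thesis by (simp add: y_def)
qed

text \<open>Measurability of a matrix-valued map is expressed through its entries, and the Leibniz
  formula makes the determinant a polynomial in them.\<close>

lemma borel_measurable_det:
  fixes A :: "'b \<Rightarrow> real mat"
  assumes "\<And>x. x \<in> space N \<Longrightarrow> A x \<in> carrier_mat d d"
    and "\<And>i j. i < d \<Longrightarrow> j < d \<Longrightarrow> (\<lambda>x. A x $$ (i, j)) \<in> borel_measurable N"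
  shows "(\<lambda>x. det (A x)) \<in> borel_measurable N"
proof -
  have "(\<lambda>x. det (A x)) \<in> borel_measurable N \<longleftrightarrow>
    (\<lambda>x. \<Sum>p \<in> {p. p permutes {0..<d}}. signof p * (\<Prod>i = 0..<d. A x $$ (i, p i))) \<in> borel_measurable N"
    using assms(1) by (intro measurable_cong det_def')
  also have \<dots>
    by (intro borel_measurable_sum borel_measurable_times borel_measurable_prod borel_measurable_const assms(2))
      (auto simp: permutes_in_image)
  finally show ?thesis .
qed

lemma borel_measurable_mat_inv:
  assumes A: "\<And>x. x \<in> space N \<Longrightarrow> A x \<in> carrier_mat d d" "\<And>x. x \<in> space N \<Longrightarrow> det (A x) \<noteq> 0"
    and m: "\<And>i j. i < d \<Longrightarrow> j < d \<Longrightarrow> (\<lambda>x. A x $$ (i, j)) \<in> borel_measurable N"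
    and i: "i < d" and j: "j < d"
  shows "(\<lambda>x. mat_inv (A x) $$ (i, j)) \<in> borel_measurable N"
proof -
  have "mat_inv (A x) $$ (i, j) = 1 / det (A x) * ((- 1) ^ (j + i) * det (mat_delete (A x) j i))"
    if "x \<in> space N" for x
    using mat_inv_eq_adj_mat[OF A[OF that]] A(1)[OF that] adj_mat(1)[OF A(1)[OF that]] i j
    by (simp add: adj_mat_def cofactor_def)
  then have "(\<lambda>x. mat_inv (A x) $$ (i, j)) \<in> borel_measurable N \<longleftrightarrow>
    (\<lambda>x. 1 / det (A x) * ((- 1) ^ (j + i) * det (mat_delete (A x) j i))) \<in> borel_measurable N"
    by (intro measurable_cong)
  also have \<dots>
  proof (intro borel_measurable_times borel_measurable_divide borel_measurable_const)
    show "(\<lambda>x. det (A x)) \<in> borel_measurable N" by (intro borel_measurable_det[of _ _ d] A m)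
    show "(\<lambda>x. det (mat_delete (A x) j i)) \<in> borel_measurable N"
    proof (rule borel_measurable_det[of _ _ "d - 1"])
      show "mat_delete (A x) j i \<in> carrier_mat (d - 1) (d - 1)" if "x \<in> space N" for x
        using A(1)[OF that] by (rule mat_delete_carrier)
      fix k l assume kl: "k < d - 1" "l < d - 1"
      have "(\<lambda>x. mat_delete (A x) j i $$ (k, l)) \<in> borel_measurable N \<longleftrightarrow>
        (\<lambda>x. A x $$ (if k < j then k else Suc k, if l < i then l else Suc l)) \<in> borel_measurable N"
      proof (rule measurable_cong)
        fix x assume "x \<in> space N"
        from A(1)[OF this] kl show "mat_delete (A x) j i $$ (k, l) =
          A x $$ (if k < j then k else Suc k, if l < i then l else Suc l)"
          by (simp add: mat_delete_def)
      qed
      also have \<dots> using kl by (intro m) auto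
      finally show "(\<lambda>x. mat_delete (A x) j i $$ (k, l)) \<in> borel_measurable N" .
    qed
  qed
  finally show ?thesis .
qed

section \<open>The innovation covariance, bounded below uniformly in the predictor\<close>

lemma cat_cov_carrier: "p \<in> carrier_vec k \<Longrightarrow> cat_cov p \<in> carrier_mat k k"
  unfolding cat_cov_def by (intro minus_carrier_mat) (simp add: outer_prod_def)

lemma cat_cov_index:
  "p \<in> carrier_vec k \<Longrightarrow> i < k \<Longrightarrow> j < k \<Longrightarrow>
    cat_cov p $$ (i, j) = (if i = j then p $ i else 0) - p $ i * p $ j"
  by (simp add: cat_cov_def outer_prod_def diag_vec_def mat_diag_def)

text \<open>A variance is nonnegative. Through this inequality the spread of the state-dependent
  means can only enlarge the innovation covariance.\<close>

lemma weighted_mean_square_le: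
  assumes "prob_vec k p"
  shows "(\<Sum>i<k. p $ i * z i)\<^sup>2 \<le> (\<Sum>i<k. p $ i * (z i)\<^sup>2)"
proof -
  define m where "m = (\<Sum>i<k. p $ i * z i)"
  have "0 \<le> (\<Sum>i<k. p $ i * (z i - m)\<^sup>2)"
    using assms by (intro sum_nonneg mult_nonneg_nonneg) (auto simp: prob_vec_def)
  also have "\<dots> = (\<Sum>i<k. p $ i * (z i)\<^sup>2) - 2 * m * (\<Sum>i<k. p $ i * z i) + m\<^sup>2 * (\<Sum>i<k. p $ i)"
    by (simp add: sum_distrib_left sum.distrib[symmetric] sum_subtractf[symmetric] power2_eq_square algebra_simps)
  also have "\<dots> = (\<Sum>i<k. p $ i * (z i)\<^sup>2) - m\<^sup>2"
    using assms by (simp add: prob_vec_def m_def[symmetric] power2_eq_square)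
  finally show ?thesis by (simp add: m_def)
qed

context hmm_model
begin

definition mu :: "'u \<Rightarrow> nat \<Rightarrow> nat \<Rightarrow> real" where
  "mu u a i = omean M u i $ a"

definition pred_obs :: "'u \<Rightarrow> real vec \<Rightarrow> nat \<Rightarrow> real" where
  "pred_obs u p a = (\<Sum>i<n. p $ i * mu u a i)"

text \<open>The matrix inverted in \<open>gain\<close>. It is the covariance of the observation
  under the predictive mixture: spread of the means plus averaged noise.\<close>

definition innov_cov :: "'u \<Rightarrow> real vec \<Rightarrow> real mat" where
  "innov_cov u p =
    mean_mat M u * cat_cov p * transpose_mat (mean_mat M u) + avg_cov M u p"

lemma mean_mat_carrier: "mean_mat M u \<in> carrier_mat (odim M u) n"
  by (simp add: mean_mat_def mat_of_cols_def)

lemma mean_mat_index: "a < odim M u \<Longrightarrow> i < n \<Longrightarrow> mean_mat M u $$ (a, i) = mu u a i"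
  by (simp add: mean_mat_def mu_def mat_of_cols_def)

lemma innov_cov_carrier: "innov_cov u p \<in> carrier_mat (odim M u) (odim M u)"
  unfolding innov_cov_def avg_cov_def by (rule carrier_matI) simp_all

text \<open>An entry of the cross-covariance between the indicator of state \<open>i\<close> and
  observation component \<open>b\<close>.\<close>

lemma cat_cov_mean_mat_index:
  assumes "p \<in> carrier_vec n" "i < n" "b < odim M u"
  shows "(cat_cov p * transpose_mat (mean_mat M u)) $$ (i, b) = p $ i * (mu u b i - pred_obs u p b)"
proof -
  have "(cat_cov p * transpose_mat (mean_mat M u)) $$ (i, b) =
    (\<Sum>j<n. ((if i = j then p $ i else 0) - p $ i * p $ j) * mu u b j)"
    using assms mean_mat_carrier[of u] cat_cov_carrier[OF assms(1)]
    by (simp add: scalar_prod_def lessThan_atLeast0 mean_mat_index cat_cov_index[OF assms(1)])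
  also have "\<dots> = (\<Sum>j<n. (if i = j then p $ i * mu u b j else 0) - p $ i * (p $ j * mu u b j))"
    by (intro sum.cong) (auto simp: algebra_simps)
  also have "\<dots> = p $ i * mu u b i - p $ i * pred_obs u p b"
    using assms by (simp add: sum_subtractf pred_obs_def sum_distrib_left)
  finally show ?thesis by (simp add: algebra_simps)
qed

lemma innov_cov_index:
  assumes p: "p \<in> carrier_vec n" and a: "a < odim M u" and b: "b < odim M u"
  shows "innov_cov u p $$ (a, b) = (\<Sum>i<n. p $ i * mu u a i * mu u b i) - pred_obs u p a * pred_obs u p b
    + (\<Sum>i<n. p $ i * ocov M u i $$ (a, b))"
proof -
  have "mean_mat M u * cat_cov p * transpose_mat (mean_mat M u) =
      mean_mat M u * (cat_cov p * transpose_mat (mean_mat M u))"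
    using mean_mat_carrier[of u] cat_cov_carrier[OF p] by (intro assoc_mult_mat) auto
  moreover have "(mean_mat M u * (cat_cov p * transpose_mat (mean_mat M u))) $$ (a, b) =
      (\<Sum>i<n. mu u a i * (cat_cov p * transpose_mat (mean_mat M u)) $$ (i, b))"
    using mean_mat_carrier[of u] cat_cov_carrier[OF p] a b
    by (subst index_mult_mat) (auto simp: scalar_prod_def lessThan_atLeast0 mean_mat_index intro!: sum.cong)
  moreover have "\<dots> = (\<Sum>i<n. p $ i * mu u a i * mu u b i) - pred_obs u p a * pred_obs u p b"
    by (simp add: cat_cov_mean_mat_index[OF p _ b] algebra_simps sum_subtractf pred_obs_def[of u p a] sum_distrib_left)
  ultimately show ?thesis using a b mean_mat_carrier[of u]
    by (simp add: innov_cov_def avg_cov_def)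
qed

text \<open>The first two terms form the variance, under \<open>p\<close>, of the mean observation
  in direction \<open>y\<close>; the last is the averaged noise.\<close>

lemma quad_form_innov_cov:
  assumes p: "p \<in> carrier_vec n"
  shows "quad_form (odim M u) (innov_cov u p) y =
    (\<Sum>i<n. p $ i * (\<Sum>a<odim M u. mu u a i * y a)\<^sup>2) - (\<Sum>i<n. p $ i * (\<Sum>a<odim M u. mu u a i * y a))\<^sup>2
    + (\<Sum>i<n. p $ i * quad_form (odim M u) (ocov M u i) y)"
proof -
  let ?d = "odim M u"
  have "quad_form ?d (innov_cov u p) y =
    (\<Sum>a<?d. \<Sum>b<?d. (\<Sum>i<n. p $ i * ((mu u a i * y a) * (mu u b i * y b)))
       - (pred_obs u p a * y a) * (pred_obs u p b * y b)
       + (\<Sum>i<n. p $ i * (ocov M u i $$ (a, b) * y a * y b)))"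
    unfolding quad_form_def
    by (intro sum.cong refl)
      (simp add: innov_cov_index[OF p] ring_distribs sum_distrib_right sum_distrib_left mult_ac)
  also have "\<dots> = (\<Sum>a<?d. \<Sum>b<?d. \<Sum>i<n. p $ i * ((mu u a i * y a) * (mu u b i * y b)))
       - (\<Sum>a<?d. pred_obs u p a * y a)\<^sup>2
       + (\<Sum>a<?d. \<Sum>b<?d. \<Sum>i<n. p $ i * (ocov M u i $$ (a, b) * y a * y b))"
    by (simp add: sum.distrib sum_subtractf power2_eq_square sum_product)
  also have "(\<Sum>a<?d. \<Sum>b<?d. \<Sum>i<n. p $ i * ((mu u a i * y a) * (mu u b i * y b))) =
      (\<Sum>i<n. \<Sum>a<?d. \<Sum>b<?d. p $ i * ((mu u a i * y a) * (mu u b i * y b)))"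
    by (subst (2) sum.swap, subst sum.swap) simp
  also have "\<dots> = (\<Sum>i<n. p $ i * (\<Sum>a<?d. mu u a i * y a)\<^sup>2)"
    unfolding power2_eq_square sum_product by (simp add: sum_distrib_left)
  also have "(\<Sum>a<?d. \<Sum>b<?d. \<Sum>i<n. p $ i * (ocov M u i $$ (a, b) * y a * y b)) =
      (\<Sum>i<n. \<Sum>a<?d. \<Sum>b<?d. p $ i * (ocov M u i $$ (a, b) * y a * y b))"
    by (subst (2) sum.swap, subst sum.swap) simp
  also have "\<dots> = (\<Sum>i<n. p $ i * quad_form ?d (ocov M u i) y)"
    by (simp add: quad_form_def sum_distrib_left)
  also have "(\<Sum>a<?d. pred_obs u p a * y a) = (\<Sum>i<n. p $ i * (\<Sum>a<?d. mu u a i * y a))"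
    unfolding pred_obs_def sum_distrib_right sum_distrib_left by (subst sum.swap) (simp add: mult_ac)
  finally show ?thesis .
qed

text \<open>The order of the quantifiers is the point: one \<open>K\<close> serves all predictors,
  so the gain stays bounded over the whole simplex. The noise alone suffices, since an average with
  total weight one keeps a common coercivity constant and the spread of the means only adds.\<close>

lemma innov_cov_coercive:
  assumes u: "u \<in> ctrls M"
  shows "\<exists>K>0. \<forall>p y. prob_vec n p \<longrightarrow>
    (\<Sum>a<odim M u. (y a)\<^sup>2) \<le> K * quad_form (odim M u) (innov_cov u p) y"
proof -
  let ?d = "odim M u"
  have "\<forall>i\<in>{..<n}. \<exists>K>0. \<forall>y. (\<Sum>a<?d. (y a)\<^sup>2) \<le> K * quad_form ?d (ocov M u i) y"
    using pos_def_coercive[OF ocov_pos_def[OF u]] by auto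
  then obtain K where K: "\<And>i. i < n \<Longrightarrow> K i > 0"
    "\<And>i y. i < n \<Longrightarrow> (\<Sum>a<?d. (y a)\<^sup>2) \<le> K i * quad_form ?d (ocov M u i) y"
    unfolding bchoice_iff by auto
  \<comment> \<open>The sum exceeds each \<open>K i\<close>; the summand 1 makes positivity
    immediate.\<close>
  define L where "L = 1 + (\<Sum>i<n. K i)"
  have L: "L > 0" unfolding L_def using K(1) by (intro add_pos_nonneg sum_nonneg) (auto intro: less_imp_le)
  have KL: "K i \<le> L" if "i < n" for i
  proof -
    have "K i \<le> (\<Sum>i<n. K i)" using that K(1) by (intro member_le_sum) (auto intro: less_imp_le)
    then show ?thesis by (simp add: L_def)
  qed
  have "(\<Sum>a<?d. (y a)\<^sup>2) \<le> L * quad_form ?d (innov_cov u p) y" if p: "prob_vec n p" for p y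
  proof -
    have nn: "0 \<le> quad_form ?d (ocov M u i) y" if "i < n" for i
      using order_trans[OF sum_nonneg K(2)[OF that, of y]] K(1)[OF that] by (simp add: zero_le_mult_iff)
    have "(\<Sum>a<?d. (y a)\<^sup>2) = (\<Sum>i<n. p $ i * (\<Sum>a<?d. (y a)\<^sup>2))"
      using p by (simp add: sum_distrib_right[symmetric] prob_vec_def)
    also have "\<dots> \<le> (\<Sum>i<n. p $ i * (L * quad_form ?d (ocov M u i) y))"
    proof (intro sum_mono mult_left_mono)
      fix i assume "i \<in> {..<n}"
      then have i: "i < n" by simp
      show "(\<Sum>a<?d. (y a)\<^sup>2) \<le> L * quad_form ?d (ocov M u i) y"
        using K(2)[OF i, of y] mult_right_mono[OF KL[OF i] nn[OF i]] by linarith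
      show "0 \<le> p $ i" using p i by (simp add: prob_vec_def)
    qed
    also have "\<dots> = L * (\<Sum>i<n. p $ i * quad_form ?d (ocov M u i) y)"
      by (simp add: sum_distrib_left mult_ac)
    also have "\<dots> \<le> L * quad_form ?d (innov_cov u p) y"
      using weighted_mean_square_le[OF p, of "\<lambda>i. \<Sum>a<?d. mu u a i * y a"] L p
      by (intro mult_left_mono) (auto simp: quad_form_innov_cov prob_vec_def)
    finally show ?thesis .
  qed
  then show ?thesis using L by blast
qed

lemma innov_cov_pos_def:
  assumes u: "u \<in> ctrls M" and p: "prob_vec n p"
  shows "pos_def (odim M u) (innov_cov u p)"
proof -
  let ?d = "odim M u"
  have pc: "p \<in> carrier_vec n" using p by (simp add: prob_vec_def)
  have "innov_cov u p $$ (a, b) = innov_cov u p $$ (b, a)" if "a < ?d" "b < ?d" for a b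
    using that ocov_pos_def[OF u] by (auto simp: innov_cov_index[OF pc] pos_def_iff_quad_form mult_ac intro!: sum.cong)
  moreover have "0 < quad_form ?d (innov_cov u p) y" if y: "\<exists>a<?d. y a \<noteq> 0" for y
  proof -
    obtain K where K: "K > 0" "(\<Sum>a<?d. (y a)\<^sup>2) \<le> K * quad_form ?d (innov_cov u p) y"
      using innov_cov_coercive[OF u] p by blast
    obtain a where "a < ?d" "y a \<noteq> 0" using y by blast
    then have "0 < (\<Sum>a<?d. (y a)\<^sup>2)" by (intro sum_pos2[of _ a]) auto
    then have "0 < K * quad_form ?d (innov_cov u p) y" using K(2) by linarith
    then show ?thesis using K(1) by (simp add: zero_less_mult_iff)
  qed
  ultimately show ?thesis using innov_cov_carrier by (auto simp: pos_def_iff_quad_form)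
qed

section \<open>The filter estimate: measurability and quadratic growth of the stage cost\<close>

definition gain_entry :: "'u \<Rightarrow> real vec \<Rightarrow> nat \<Rightarrow> nat \<Rightarrow> real" where
  "gain_entry u p i a = (\<Sum>b<odim M u. p $ i * (mu u b i - pred_obs u p b) * mat_inv (innov_cov u p) $$ (b, a))"

definition est_entry :: "'u \<Rightarrow> real vec \<Rightarrow> (nat \<Rightarrow> real) \<Rightarrow> nat \<Rightarrow> real" where
  "est_entry u p y i = p $ i + (\<Sum>a<odim M u. gain_entry u p i a * (y a - pred_obs u p a))"

lemma filter_est_index:
  assumes u: "u \<in> ctrls M" and p: "prob_vec n p" and i: "i < n"
  shows "filter_est M u p (obs_vec M u y) \<in> carrier_vec n"
    "filter_est M u p (obs_vec M u y) $ i = est_entry u p y i"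
proof -
  let ?d = "odim M u"
  have pc: "p \<in> carrier_vec n" using p by (simp add: prob_vec_def)
  have d0: "det (innov_cov u p) \<noteq> 0" using pos_def_det_pos[OF innov_cov_pos_def[OF u p]] by simp
  define B where "B = mat_inv (innov_cov u p)"
  have B: "B \<in> carrier_mat ?d ?d" unfolding B_def by (rule mat_inv_correct(1)[OF innov_cov_carrier d0])
  define T where "T = cat_cov p * transpose_mat (mean_mat M u)"
  have T: "T \<in> carrier_mat n ?d" unfolding T_def
    using mean_mat_carrier[of u] cat_cov_carrier[OF pc] by (intro mult_carrier_mat) auto
  have G: "gain M u p = T * B" by (simp add: gain_def Let_def T_def B_def innov_cov_def)
  have Gc: "T * B \<in> carrier_mat n ?d" using T B by (rule mult_carrier_mat)
  have Gi: "(T * B) $$ (i, a) = gain_entry u p i a" if "a < ?d" for a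
    using T B i that cat_cov_mean_mat_index[OF pc i, of _ u, folded T_def]
    by (simp add: scalar_prod_def gain_entry_def B_def lessThan_atLeast0)
  define z where "z = obs_vec M u y - mean_mat M u *\<^sub>v p"
  have z: "z \<in> carrier_vec ?d" unfolding z_def using mean_mat_carrier[of u] by (intro carrier_vecI) auto
  have zi: "z $ a = y a - pred_obs u p a" if "a < ?d" for a
    using that mean_mat_carrier[of u] pc
    by (simp add: z_def obs_vec_def scalar_prod_def pred_obs_def lessThan_atLeast0 mean_mat_index mult_ac)
  have F: "filter_est M u p (obs_vec M u y) = p + (T * B) *\<^sub>v z"
    by (simp only: filter_est_def G z_def)
  show "filter_est M u p (obs_vec M u y) \<in> carrier_vec n"
    unfolding F using pc mult_mat_vec_carrier[OF Gc z] by simp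
  have "((T * B) *\<^sub>v z) $ i = (\<Sum>a<?d. (T * B) $$ (i, a) * z $ a)"
    using Gc z i T B unfolding lessThan_atLeast0
    by (subst index_mult_mat_vec) (auto simp: scalar_prod_def intro!: sum.cong)
  then show "filter_est M u p (obs_vec M u y) $ i = est_entry u p y i"
    unfolding F using pc i T mult_mat_vec_carrier[OF Gc z]
    by (simp add: est_entry_def Gi zi)
qed

text \<open>The past enters only through the predictor \<open>p\<close>, so a bound uniform over the
  simplex is a bound uniform over all histories.\<close>

definition err_cost :: "'u \<Rightarrow> real vec \<Rightarrow> (nat \<Rightarrow> real) \<Rightarrow> real" where
  "err_cost u p y = trace (cat_cov (filter_est M u p (obs_vec M u y)))"

text \<open>Supplies the index that \<open>filter_est_index\<close> asks for even in its dimension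
  claim.\<close>

lemma n_pos: "0 < n"
proof (rule ccontr)
  assume "\<not> 0 < n"
  then show False using init_prob_vec by (simp add: prob_vec_def)
qed

lemma err_cost_eq:
  assumes u: "u \<in> ctrls M" and p: "prob_vec n p"
  shows "err_cost u p y = (\<Sum>i<n. est_entry u p y i - est_entry u p y i * est_entry u p y i)"
proof -
  note E = filter_est_index[OF u p]
  have c: "filter_est M u p (obs_vec M u y) \<in> carrier_vec n" using E(1) n_pos .
  then show ?thesis using cat_cov_carrier[OF c]
    by (simp add: err_cost_def trace_def cat_cov_index[OF c] E(2))
qed

text \<open>Predictor and observation depend on an abstract parameter \<open>x\<close>, so that a
  whole observation history can be substituted, with the predictor varying along it.\<close>

lemma measurable_err_cost:
  assumes u: "u \<in> ctrls M"
    and p: "\<And>x. x \<in> space N \<Longrightarrow> prob_vec n (p x)"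
      "\<And>i. i < n \<Longrightarrow> (\<lambda>x. p x $ i) \<in> borel_measurable N"
    and y: "\<And>a. a < odim M u \<Longrightarrow> (\<lambda>x. y x a) \<in> borel_measurable N"
  shows "(\<lambda>x. err_cost u (p x) (y x)) \<in> borel_measurable N"
proof -
  let ?d = "odim M u"
  have pc: "\<And>x. x \<in> space N \<Longrightarrow> p x \<in> carrier_vec n" using p(1) by (simp add: prob_vec_def)
  have po: "(\<lambda>x. pred_obs u (p x) a) \<in> borel_measurable N" for a
    unfolding pred_obs_def by (intro borel_measurable_sum borel_measurable_times p borel_measurable_const) auto
  have ic: "(\<lambda>x. innov_cov u (p x) $$ (a, b)) \<in> borel_measurable N" if "a < ?d" "b < ?d" for a b
  proof -
    have "(\<lambda>x. innov_cov u (p x) $$ (a, b)) \<in> borel_measurable N \<longleftrightarrow>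
      (\<lambda>x. (\<Sum>i<n. p x $ i * mu u a i * mu u b i) - pred_obs u (p x) a * pred_obs u (p x) b
        + (\<Sum>i<n. p x $ i * ocov M u i $$ (a, b))) \<in> borel_measurable N"
      using that by (intro measurable_cong innov_cov_index pc)
    also have \<dots>
      by (intro borel_measurable_add borel_measurable_diff borel_measurable_sum borel_measurable_times
        borel_measurable_const po p) auto
    finally show ?thesis .
  qed
  have iv: "(\<lambda>x. mat_inv (innov_cov u (p x)) $$ (a, b)) \<in> borel_measurable N" if "a < ?d" "b < ?d" for a b
  proof (rule borel_measurable_mat_inv[OF innov_cov_carrier _ ic that])
    show "det (innov_cov u (p x)) \<noteq> 0" if "x \<in> space N" for x
      using pos_def_det_pos[OF innov_cov_pos_def[OF u p(1)[OF that]]] by simp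
  qed
  have est: "(\<lambda>x. est_entry u (p x) (y x) i) \<in> borel_measurable N" if "i < n" for i
    unfolding est_entry_def gain_entry_def
    by (intro borel_measurable_add borel_measurable_diff borel_measurable_sum borel_measurable_times
        borel_measurable_const po p iv y that) auto
  have "(\<lambda>x. err_cost u (p x) (y x)) \<in> borel_measurable N \<longleftrightarrow>
    (\<lambda>x. \<Sum>i<n. est_entry u (p x) (y x) i - est_entry u (p x) (y x) i * est_entry u (p x) (y x) i)
      \<in> borel_measurable N"
    by (intro measurable_cong err_cost_eq u p)
  also have \<dots>
    by (intro borel_measurable_diff borel_measurable_sum borel_measurable_times est) auto
  finally show ?thesis .
qed

text \<open>The gain is bounded uniformly in \<open>p\<close>, so each entry \<open>e\<close> of the
  estimate grows at most linearly in the observation, and \<open>e - e * e\<close> at most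
  quadratically.\<close>

lemma err_cost_bound:
  assumes u: "u \<in> ctrls M"
  shows "\<exists>C\<ge>0. \<forall>p y. prob_vec n p \<longrightarrow> \<bar>err_cost u p y\<bar> \<le> C * obs_size u y"
proof -
  let ?d = "odim M u"
  obtain K where K: "K > 0" "\<And>p y. prob_vec n p \<Longrightarrow>
      (\<Sum>a<?d. (y a)\<^sup>2) \<le> K * quad_form ?d (innov_cov u p) y"
    using innov_cov_coercive[OF u] by blast
  define c where "c = (\<Sum>a<?d. \<Sum>i<n. \<bar>mu u a i\<bar>)"
  have c0: "0 \<le> c" by (simp add: c_def sum_nonneg)
  have mu_c: "\<bar>mu u a i\<bar> \<le> c" if "a < ?d" "i < n" for a i
  proof -
    have "\<bar>mu u a i\<bar> \<le> (\<Sum>i<n. \<bar>mu u a i\<bar>)"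
      using that by (intro member_le_sum[of i "{..<n}" "\<lambda>i. \<bar>mu u a i\<bar>"]) auto
    also have "\<dots> \<le> c" unfolding c_def
      using that by (intro member_le_sum[of a "{..<?d}" "\<lambda>a. \<Sum>i<n. \<bar>mu u a i\<bar>"]) (auto simp: sum_nonneg)
    finally show ?thesis .
  qed
  \<comment> \<open>Bounds a gain entry: there are \<open>odim M u\<close> summands, in each of
    which the deviation of a mean from its average is at most \<open>2 * c\<close> and the entry of
    the inverse at most \<open>K\<close>.\<close>
  define g where "g = real ?d * (2 * c * K)"
  \<comment> \<open>Per state this is \<open>2 * (1 + E)\<close>, where \<open>E\<close> is the
    bound for \<open>e * e\<close> relative to \<open>obs_size\<close>, after the estimate of
    \<open>e - e * e\<close> by \<open>1 + 2 * (e * e)\<close>.\<close>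
  define C where "C = real n * (2 + 4 * (1 + g * (real ?d * c))\<^sup>2 + 4 * g\<^sup>2 * real ?d)"
  have g0: "0 \<le> g" using c0 K(1) by (simp add: g_def)
  have "\<bar>err_cost u p y\<bar> \<le> C * obs_size u y" if p: "prob_vec n p" for p y
  proof -
    have p1: "0 \<le> p $ i" "p $ i \<le> 1" if "i < n" for i
      using p that prob_vec_le_1[OF p that] by (auto simp: prob_vec_def)
    have po: "\<bar>pred_obs u p a\<bar> \<le> c" if "a < ?d" for a
    proof -
      have "\<bar>pred_obs u p a\<bar> \<le> (\<Sum>i<n. \<bar>p $ i * mu u a i\<bar>)" unfolding pred_obs_def by (rule sum_abs)
      also have "\<dots> \<le> (\<Sum>i<n. p $ i * c)"
        using mu_c[OF that] p1 by (intro sum_mono) (auto simp: abs_mult intro!: mult_left_mono)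
      also have "\<dots> = c" using p by (simp add: sum_distrib_right[symmetric] prob_vec_def)
      finally show ?thesis .
    qed
    have ge: "\<bar>gain_entry u p i a\<bar> \<le> g" if "i < n" "a < ?d" for i a
    proof -
      have "\<bar>gain_entry u p i a\<bar> \<le> (\<Sum>b<?d. \<bar>p $ i * (mu u b i - pred_obs u p b) * mat_inv (innov_cov u p) $$ (b, a)\<bar>)"
        unfolding gain_entry_def by (rule sum_abs)
      also have "\<dots> \<le> (\<Sum>b<?d. 2 * c * K)"
      proof (rule sum_mono)
        fix b assume "b \<in> {..<?d}"
        then have b: "b < ?d" by simp
        have 1: "\<bar>mat_inv (innov_cov u p) $$ (b, a)\<bar> \<le> K"
          by (rule mat_inv_entry_le[OF innov_cov_pos_def[OF u p] K(2)[OF p] b that(2)])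
        have "\<bar>mu u b i - pred_obs u p b\<bar> \<le> 2 * c" using mu_c[OF b that(1)] po[OF b] by linarith
        then have 2: "\<bar>p $ i\<bar> * \<bar>mu u b i - pred_obs u p b\<bar> \<le> 1 * (2 * c)"
          using p1[OF that(1)] by (intro mult_mono) auto
        have "(\<bar>p $ i\<bar> * \<bar>mu u b i - pred_obs u p b\<bar>) * \<bar>mat_inv (innov_cov u p) $$ (b, a)\<bar> \<le> (2 * c) * K"
          by (rule mult_mono) (use 1 2 c0 in auto)
        then show "\<bar>p $ i * (mu u b i - pred_obs u p b) * mat_inv (innov_cov u p) $$ (b, a)\<bar> \<le> 2 * c * K"
          by (simp add: abs_mult)
      qed
      also have "\<dots> = g" by (simp add: g_def)
      finally show ?thesis .
    qed
    have en: "\<bar>est_entry u p y i - est_entry u p y i * est_entry u p y i\<bar>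
        \<le> (2 + 4 * (1 + g * (real ?d * c))\<^sup>2 + 4 * g\<^sup>2 * real ?d) * obs_size u y" if i: "i < n" for i
    proof -
      define e where "e = est_entry u p y i"
      define S where "S = (\<Sum>a<?d. \<bar>y a\<bar>)"
      define s where "s = 1 + g * (real ?d * c)"
      have "\<bar>\<Sum>a<?d. gain_entry u p i a * (y a - pred_obs u p a)\<bar> \<le>
          (\<Sum>a<?d. \<bar>gain_entry u p i a * (y a - pred_obs u p a)\<bar>)" by (rule sum_abs)
      also have "\<dots> \<le> (\<Sum>a<?d. g * (\<bar>y a\<bar> + c))"
      proof (rule sum_mono)
        fix a assume "a \<in> {..<?d}"
        then have a: "a < ?d" by simp
        have "\<bar>y a - pred_obs u p a\<bar> \<le> \<bar>y a\<bar> + c" using po[OF a] by linarith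
        then show "\<bar>gain_entry u p i a * (y a - pred_obs u p a)\<bar> \<le> g * (\<bar>y a\<bar> + c)"
          unfolding abs_mult using ge[OF i a] g0 by (intro mult_mono) auto
      qed
      also have "\<dots> = g * S + g * (real ?d * c)"
        by (simp add: S_def sum.distrib sum_distrib_left ring_distribs)
      finally have "\<bar>e\<bar> \<le> s + g * S" using p1[OF i] unfolding e_def est_entry_def s_def by linarith
      then have "e\<^sup>2 \<le> (s + g * S)\<^sup>2" by (metis abs_ge_zero power2_abs power_mono)
      also have "\<dots> \<le> 2 * s\<^sup>2 + 2 * (g * S)\<^sup>2"
        using zero_le_power2[of "s - g * S"] by (simp add: power2_eq_square algebra_simps)
      also have "\<dots> \<le> 2 * s\<^sup>2 + 2 * (g\<^sup>2 * (real ?d * (\<Sum>a<?d. (y a)\<^sup>2)))"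
      proof -
        have "S\<^sup>2 \<le> real ?d * (\<Sum>a<?d. (y a)\<^sup>2)"
          using Cauchy_Schwarz_ineq_sum[of "\<lambda>_. 1" "\<lambda>a. \<bar>y a\<bar>" "{..<?d}"] by (simp add: S_def)
        then show ?thesis by (simp add: power_mult_distrib mult_left_mono)
      qed
      also have "\<dots> \<le> 2 * s\<^sup>2 * obs_size u y + 2 * (g\<^sup>2 * (real ?d * obs_size u y))"
      proof -
        have "2 * s\<^sup>2 * 1 \<le> 2 * s\<^sup>2 * obs_size u y" by (intro mult_left_mono obs_size_ge_1) auto
        moreover have "(\<Sum>a<?d. (y a)\<^sup>2) \<le> obs_size u y" by (simp add: obs_size_def)
        then have "g\<^sup>2 * (real ?d * (\<Sum>a<?d. (y a)\<^sup>2)) \<le> g\<^sup>2 * (real ?d * obs_size u y)"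
          by (intro mult_left_mono) auto
        ultimately show ?thesis by linarith
      qed
      finally have e2: "e\<^sup>2 \<le> (2 * s\<^sup>2 + 2 * g\<^sup>2 * real ?d) * obs_size u y" by (simp add: algebra_simps)
      have "2 * e \<le> 1 + e * e" "- (2 * e) \<le> 1 + e * e" "0 \<le> e * e"
        using zero_le_power2[of "e - 1"] zero_le_power2[of "e + 1"]
        by (simp_all add: power2_eq_square algebra_simps)
      then have "\<bar>e - e * e\<bar> \<le> 1 + 2 * e\<^sup>2" unfolding power2_eq_square by linarith
      also have "\<dots> \<le> 2 * obs_size u y + 2 * ((2 * s\<^sup>2 + 2 * g\<^sup>2 * real ?d) * obs_size u y)"
        using e2 obs_size_ge_1[of u y] by linarith
      finally show ?thesis by (simp add: e_def s_def algebra_simps)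
    qed
    have "\<bar>err_cost u p y\<bar> \<le> (\<Sum>i<n. \<bar>est_entry u p y i - est_entry u p y i * est_entry u p y i\<bar>)"
      unfolding err_cost_eq[OF u p] by (rule sum_abs)
    also have "\<dots> \<le> (\<Sum>i<n. (2 + 4 * (1 + g * (real ?d * c))\<^sup>2 + 4 * g\<^sup>2 * real ?d) * obs_size u y)"
      using en by (intro sum_mono) auto
    finally show ?thesis by (simp add: C_def mult_ac)
  qed
  moreover have "0 \<le> C" unfolding C_def using g0 by (intro mult_nonneg_nonneg add_nonneg_nonneg) auto
  ultimately show ?thesis by blast
qed

end

section \<open>Dynamic programming\<close>

text \<open>A rollout from time \<open>t\<close> writes only later components, so whatever is read
  from the first \<open>s\<close> can be frozen at the starting information vector.\<close>

lemma rollout_cong_restrict: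
  assumes "s \<le> t"
  shows "rollout M \<eta> m t (\<lambda>h'. \<Psi> (info_restrict s h') h') h =
    rollout M \<eta> m t (\<lambda>h'. \<Psi> (info_restrict s h) h') h"
  using assms by (induction m arbitrary: t h) (simp_all add: info_restrict_snoc)

text \<open>The predictor of stage \<open>k\<close> reads the controls only up to index
  \<open>k - 2\<close>. It therefore does not see the control about to be chosen and is common to
  all candidates in the minimum.\<close>

lemma predictor_cong:
  assumes "\<And>s. s < k \<Longrightarrow> fst h s = fst h' s" "\<And>s. Suc s < k \<Longrightarrow> snd h s = snd h' s"
  shows "predictor M h k = predictor M h' k"
  using assms
proof (induction k)
  case (Suc k)
  have "prev_ctrl M (snd h) k = prev_ctrl M (snd h') k"
    using Suc.prems(2) by (cases k) (auto simp: prev_ctrl_def)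
  moreover have "predictor M h k = predictor M h' k" using Suc by simp
  ultimately show ?case using Suc.prems(1)[of k] by simp
qed simp

context hmm_model
begin

section \<open>Stage cost, predictor and density at an information vector\<close>

lemma stage_cost_err_cost:
  "stage_cost M k h = err_cost (prev_ctrl M (snd h) k) (predictor M h k) (fst h k)"
  by (simp add: stage_cost_def err_cost_def Let_def)

lemma stage_cost_restrict: "stage_cost M k (info_restrict k h) = stage_cost M k h"
proof -
  have "predictor M (info_restrict k h) k = predictor M h k"
    by (rule predictor_cong) (auto simp: info_restrict_def)
  then show ?thesis
    by (simp add: stage_cost_err_cost info_restrict_def prev_ctrl_def)
qed

lemma predictor_snoc: "predictor M (info_snoc (Suc t) h y u) (Suc t) = predictor M h (Suc t)"
  by (rule predictor_cong) (auto simp: info_snoc_def)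

lemma prev_ctrl_in_ctrls: "us \<in> {..<t} \<rightarrow>\<^sub>E ctrls M \<Longrightarrow> s \<le> t \<Longrightarrow> prev_ctrl M us s \<in> ctrls M"
  using PiE_mem[of us "{..<t}" "\<lambda>_. ctrls M" "s - 1"] ctrl0 by (cases s) (simp_all add: prev_ctrl_def)

lemma info_ctrl_in_ctrls: "h \<in> info_vecs M t \<Longrightarrow> s \<le> t \<Longrightarrow> prev_ctrl M (snd h) s \<in> ctrls M"
  by (rule prev_ctrl_in_ctrls[of _ t]) (simp_all add: info_vecs_def case_prod_beta)

lemma predictor_info: "h \<in> info_vecs M t \<Longrightarrow> k \<le> Suc t \<Longrightarrow> prob_vec n (predictor M h k)"
  by (rule predictor_prob_vec) (auto intro: info_ctrl_in_ctrls)

lemma info_dens_info_pos: "h \<in> info_vecs M t \<Longrightarrow> 0 < info_dens M t h"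
  by (rule info_dens_pos) (auto intro: info_ctrl_in_ctrls)

lemma info_dens_snoc:
  assumes "h \<in> info_vecs M t"
  shows "info_dens M (Suc t) (info_snoc (Suc t) h y u) =
    info_dens M t h * mix_dens (predictor M h (Suc t)) u y"
proof -
  let ?h = "info_snoc (Suc t) h y u"
  have pc: "prev_ctrl M (snd ?h) s = prev_ctrl M (snd h) s" if "s \<le> t" for s
    using that by (auto simp: info_snoc_def prev_ctrl_def)
  have "info_dens M (Suc t) ?h = info_dens M t ?h *
    mix_dens (predictor M ?h (Suc t)) (prev_ctrl M (snd ?h) (Suc t)) (fst ?h (Suc t))"
    using assms by (intro info_dens_Suc) (simp add: pc info_ctrl_in_ctrls)
  moreover have "info_dens M t ?h = info_dens M t h"
    unfolding info_dens_def path_dens_def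
    by (intro sum.cong arg_cong2[of _ _ _ _ times] prod.cong refl) (simp add: pc, simp add: info_snoc_def)
  ultimately show ?thesis by (simp only: predictor_snoc) (simp add: info_snoc_def prev_ctrl_def)
qed

section \<open>Measurability in the observations for a fixed control history\<close>

definition info_measurable :: "nat \<Rightarrow> ('u info \<Rightarrow> real) \<Rightarrow> bool" where
  "info_measurable t F \<longleftrightarrow>
    (\<forall>us \<in> {..<t} \<rightarrow>\<^sub>E ctrls M. (\<lambda>ys. F (ys, us)) \<in> borel_measurable (obs_hist M t us))"

lemma measurable_obs_hist_component:
  "s \<le> t \<Longrightarrow> (\<lambda>ys. ys s) \<in> obs_hist M t us \<rightarrow>\<^sub>M obs_space M (prev_ctrl M us s)"
  unfolding obs_hist_def by (rule measurable_component_singleton) auto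

lemma measurable_predictor:
  assumes us: "us \<in> {..<t} \<rightarrow>\<^sub>E ctrls M" and "k \<le> Suc t" and "j < n"
  shows "(\<lambda>ys. predictor M (ys, us) k $ j) \<in> borel_measurable (obs_hist M t us)"
  using assms(2,3)
proof (induction k arbitrary: j)
  case 0
  then show ?case by simp
next
  case (Suc k)
  let ?u = "prev_ctrl M us k"
  have u: "?u \<in> ctrls M" using us Suc.prems by (intro prev_ctrl_in_ctrls) auto
  have pc: "predictor M (ys, us) k \<in> carrier_vec n" for ys
    using predictor_prob_vec[of k "(ys, us)"] prev_ctrl_in_ctrls[OF us] Suc.prems
    by (auto simp: prob_vec_def)
  have od: "(\<lambda>ys. obs_dens M ?u i (ys k)) \<in> borel_measurable (obs_hist M t us)" if "i < n" for i
    using measurable_compose[OF measurable_obs_hist_component measurable_obs_dens[OF u that]] Suc.prems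
    by simp
  show ?case
    unfolding predictor_Suc_index[OF pc Suc.prems(2)] mix_dens_def fst_conv snd_conv
    using Suc.prems
    by (intro borel_measurable_divide borel_measurable_sum borel_measurable_times borel_measurable_const
      Suc.IH od) auto
qed

lemma info_measurable_stage_cost: "info_measurable (Suc t) (stage_cost M (Suc t))"
  unfolding info_measurable_def stage_cost_err_cost fst_conv snd_conv
proof (intro ballI measurable_err_cost)
  fix us assume us: "us \<in> {..<Suc t} \<rightarrow>\<^sub>E ctrls M"
  then show u: "prev_ctrl M us (Suc t) \<in> ctrls M" by (rule prev_ctrl_in_ctrls) simp
  show "prob_vec n (predictor M (ys, us) (Suc t))" for ys
    using prev_ctrl_in_ctrls[OF us] by (intro predictor_prob_vec) auto
  show "(\<lambda>ys. predictor M (ys, us) (Suc t) $ i) \<in> borel_measurable (obs_hist M (Suc t) us)" if "i < n" for i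
    using us that by (intro measurable_predictor) auto
  fix a assume a: "a < odim M (prev_ctrl M us (Suc t))"
  have "(\<lambda>y. y a) \<in> obs_space M (prev_ctrl M us (Suc t)) \<rightarrow>\<^sub>M lborel"
    unfolding obs_space_def using a by (intro measurable_component_singleton) auto
  then show "(\<lambda>ys. ys (Suc t) a) \<in> borel_measurable (obs_hist M (Suc t) us)"
    using measurable_compose[OF measurable_obs_hist_component[of "Suc t" "Suc t" us, OF order_refl],
      of "\<lambda>y. y a" lborel] by simp
qed

definition err_bound :: real where
  "err_bound = (SOME C. 0 \<le> C \<and>
    (\<forall>u\<in>ctrls M. \<forall>p y. prob_vec n p \<longrightarrow> \<bar>err_cost u p y\<bar> \<le> C * obs_size u y))"

text \<open>The sum of the nonnegative constants of the finitely many controls witnesses the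
  choice.\<close>

lemma err_bound:
  "0 \<le> err_bound"
  "u \<in> ctrls M \<Longrightarrow> prob_vec n p \<Longrightarrow> \<bar>err_cost u p y\<bar> \<le> err_bound * obs_size u y"
proof -
  have "\<forall>u\<in>ctrls M. \<exists>C\<ge>0. \<forall>p y. prob_vec n p \<longrightarrow> \<bar>err_cost u p y\<bar> \<le> C * obs_size u y"
    using err_cost_bound by blast
  then obtain C where C: "\<And>u. u \<in> ctrls M \<Longrightarrow> 0 \<le> C u"
    "\<And>u p y. u \<in> ctrls M \<Longrightarrow> prob_vec n p \<Longrightarrow> \<bar>err_cost u p y\<bar> \<le> C u * obs_size u y"
    unfolding bchoice_iff by metis
  have "0 \<le> sum C (ctrls M) \<and>
    (\<forall>u\<in>ctrls M. \<forall>p y. prob_vec n p \<longrightarrow> \<bar>err_cost u p y\<bar> \<le> sum C (ctrls M) * obs_size u y)"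
  proof (intro conjI ballI allI impI sum_nonneg)
    fix u p y assume u: "u \<in> ctrls M" and p: "prob_vec n p"
    have "C u \<le> sum C (ctrls M)" using u C(1) finite_ctrls by (intro member_le_sum) auto
    then have "C u * obs_size u y \<le> sum C (ctrls M) * obs_size u y"
      using obs_size_ge_1[of u y] by (intro mult_right_mono) auto
    with C(2)[OF u p, of y] show "\<bar>err_cost u p y\<bar> \<le> sum C (ctrls M) * obs_size u y" by linarith
  qed (use C(1) in auto)
  then have "\<exists>C. 0 \<le> C \<and> (\<forall>u\<in>ctrls M. \<forall>p y. prob_vec n p \<longrightarrow> \<bar>err_cost u p y\<bar> \<le> C * obs_size u y)"
    by blast
  from someI_ex[OF this] show "0 \<le> err_bound"
    "u \<in> ctrls M \<Longrightarrow> prob_vec n p \<Longrightarrow> \<bar>err_cost u p y\<bar> \<le> err_bound * obs_size u y"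
    by (auto simp: err_bound_def)
qed

section \<open>One-step conditional expectation\<close>

definition step_expect :: "nat \<Rightarrow> ('u info \<Rightarrow> real) \<Rightarrow> 'u info \<Rightarrow> 'u \<Rightarrow> real" where
  "step_expect t F h u =
    (\<integral>y. mix_dens (predictor M h (Suc t)) u y * F (info_snoc (Suc t) h y u) \<partial>obs_space M u)"

lemma sigma_finite_obs_space: "sigma_finite_measure (obs_space M u)"
proof -
  interpret product_sigma_finite "\<lambda>_::nat. lborel :: real measure" by standard
  show ?thesis unfolding obs_space_def by (rule sigma_finite) simp
qed

lemma measurable_snoc:
  assumes us: "us \<in> {..<t} \<rightarrow>\<^sub>E ctrls M" and u: "u \<in> ctrls M"
    and F: "info_measurable (Suc t) F"
  shows "(\<lambda>(ys, y). F (info_snoc (Suc t) (ys, us) y u)) \<in> borel_measurable (obs_hist M t us \<Otimes>\<^sub>M obs_space M u)"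
proof -
  let ?us = "us(t := u)"
  let ?N = "\<lambda>s. obs_space M (prev_ctrl M ?us s)"
  have us': "?us \<in> {..<Suc t} \<rightarrow>\<^sub>E ctrls M"
    using us u by (auto simp: PiE_def Pi_def extensional_def less_Suc_eq)
  \<comment> \<open>\<open>prev_ctrl\<close> at \<open>s\<close> reads the control with index
    \<open>s - 1\<close>, so overwriting index \<open>t\<close> changes no factor up to time
    \<open>t\<close>.\<close>
  have "obs_hist M t us = PiM {..t} ?N"
    unfolding obs_hist_def by (intro PiM_cong refl) (auto simp: prev_ctrl_def)
  moreover have "obs_space M u = ?N (Suc t)" by (simp add: prev_ctrl_def)
  moreover have "obs_hist M (Suc t) ?us = PiM (insert (Suc t) {..t}) ?N"
    by (simp add: obs_hist_def atMost_Suc)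
  ultimately have "(\<lambda>(ys, y). ys(Suc t := y)) \<in> obs_hist M t us \<Otimes>\<^sub>M obs_space M u \<rightarrow>\<^sub>M obs_hist M (Suc t) ?us"
    using measurable_add_dim[of "Suc t" "{..t}" ?N] by simp
  from measurable_compose[OF this] F us'
  have "(\<lambda>x. F ((case x of (ys, y) \<Rightarrow> ys(Suc t := y)), ?us)) \<in> borel_measurable (obs_hist M t us \<Otimes>\<^sub>M obs_space M u)"
    by (auto simp: info_measurable_def)
  then show ?thesis by (simp add: info_snoc_def case_prod_beta)
qed

lemma measurable_snoc_section:
  assumes h: "h \<in> info_vecs M t" and u: "u \<in> ctrls M" and F: "info_measurable (Suc t) F"
  shows "(\<lambda>y. F (info_snoc (Suc t) h y u)) \<in> borel_measurable (obs_space M u)"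
proof -
  have us: "snd h \<in> {..<t} \<rightarrow>\<^sub>E ctrls M" and ys: "fst h \<in> space (obs_hist M t (snd h))"
    using h by (simp_all add: info_vecs_def case_prod_beta)
  from measurable_Pair2[OF measurable_snoc[OF us u F] ys] show ?thesis by simp
qed

lemma info_measurable_step_expect:
  assumes u: "u \<in> ctrls M" and F: "info_measurable (Suc t) F"
  shows "info_measurable t (\<lambda>h. step_expect t F h u)"
  unfolding info_measurable_def step_expect_def
proof (intro ballI sigma_finite_measure.borel_measurable_lebesgue_integral[OF sigma_finite_obs_space])
  fix us assume us: "us \<in> {..<t} \<rightarrow>\<^sub>E ctrls M"
  have 1: "(\<lambda>x. predictor M (fst x, us) (Suc t) $ i) \<in> borel_measurable (obs_hist M t us \<Otimes>\<^sub>M obs_space M u)"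
    if "i < n" for i
    using measurable_compose[OF measurable_fst measurable_predictor[OF us order_refl that]] .
  have 2: "(\<lambda>x. obs_dens M u i (snd x)) \<in> borel_measurable (obs_hist M t us \<Otimes>\<^sub>M obs_space M u)"
    if "i < n" for i
    using measurable_compose[OF measurable_snd measurable_obs_dens[OF u that]] .
  have 3: "(\<lambda>x. F (info_snoc (Suc t) (fst x, us) (snd x) u)) \<in> borel_measurable (obs_hist M t us \<Otimes>\<^sub>M obs_space M u)"
    using measurable_snoc[OF us u F] by (simp add: case_prod_beta)
  show "(\<lambda>(ys, y). mix_dens (predictor M (ys, us) (Suc t)) u y * F (info_snoc (Suc t) (ys, us) y u))
    \<in> borel_measurable (obs_hist M t us \<Otimes>\<^sub>M obs_space M u)"
    unfolding case_prod_beta mix_dens_def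
    by (intro borel_measurable_times borel_measurable_sum 1 2 3) auto
qed

text \<open>Two growth classes alternate in the inductions below: adding a stage cost leads from
  bounded to dominated functions, and one-step expectation leads back.\<close>

definition info_dominated :: "nat \<Rightarrow> ('u info \<Rightarrow> real) \<Rightarrow> bool" where
  "info_dominated t F \<longleftrightarrow> info_measurable t F \<and>
    (\<exists>C. \<forall>h\<in>info_vecs M t. \<bar>F h\<bar> \<le> C * obs_size (prev_ctrl M (snd h) t) (fst h t))"

definition info_bounded :: "nat \<Rightarrow> ('u info \<Rightarrow> real) \<Rightarrow> bool" where
  "info_bounded t F \<longleftrightarrow> info_measurable t F \<and> (\<exists>C. \<forall>h\<in>info_vecs M t. \<bar>F h\<bar> \<le> C)"

lemma info_boundedI:
  "info_measurable t F \<Longrightarrow> (\<And>h. h \<in> info_vecs M t \<Longrightarrow> \<bar>F h\<bar> \<le> C) \<Longrightarrow> info_bounded t F"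
  unfolding info_bounded_def by blast

lemma info_measurable_add:
  "info_measurable t F \<Longrightarrow> info_measurable t G \<Longrightarrow> info_measurable t (\<lambda>h. F h + G h)"
  unfolding info_measurable_def by (intro ballI borel_measurable_add) blast+

lemma info_dominated_stage_add:
  assumes "info_bounded (Suc t) F"
  shows "info_dominated (Suc t) (\<lambda>h. stage_cost M (Suc t) h + F h)"
proof -
  obtain C where C: "\<And>h. h \<in> info_vecs M (Suc t) \<Longrightarrow> \<bar>F h\<bar> \<le> C"
    using assms by (auto simp: info_bounded_def)
  have "\<bar>stage_cost M (Suc t) h + F h\<bar> \<le> (err_bound + \<bar>C\<bar>) * obs_size (prev_ctrl M (snd h) (Suc t)) (fst h (Suc t))"
    if h: "h \<in> info_vecs M (Suc t)" for h
  proof -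
    let ?s = "obs_size (prev_ctrl M (snd h) (Suc t)) (fst h (Suc t))"
    have "\<bar>stage_cost M (Suc t) h\<bar> \<le> err_bound * ?s" unfolding stage_cost_err_cost
      using h by (intro err_bound info_ctrl_in_ctrls predictor_info) auto
    moreover have "\<bar>F h\<bar> \<le> \<bar>C\<bar> * ?s"
      using C[OF h] mult_left_mono[OF obs_size_ge_1, of "\<bar>C\<bar>"] by (smt (verit) abs_ge_zero mult.right_neutral)
    ultimately show ?thesis by (simp add: ring_distribs)
  qed
  moreover have "info_measurable (Suc t) (\<lambda>h. stage_cost M (Suc t) h + F h)"
    using assms unfolding info_bounded_def by (intro info_measurable_add info_measurable_stage_cost) blast
  ultimately show ?thesis unfolding info_dominated_def by blast
qed

lemma snoc_last:
  "prev_ctrl M (snd (info_snoc (Suc t) h y u)) (Suc t) = u" "fst (info_snoc (Suc t) h y u) (Suc t) = y"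
  by (simp_all add: info_snoc_def prev_ctrl_def)

lemma step_integrable:
  assumes F: "info_dominated (Suc t) F" and h: "h \<in> info_vecs M t" and u: "u \<in> ctrls M"
  shows "integrable (obs_space M u) (\<lambda>y. mix_dens (predictor M h (Suc t)) u y * F (info_snoc (Suc t) h y u))"
proof -
  let ?p = "predictor M h (Suc t)"
  obtain C where C: "\<And>h. h \<in> info_vecs M (Suc t) \<Longrightarrow> \<bar>F h\<bar> \<le> C * obs_size (prev_ctrl M (snd h) (Suc t)) (fst h (Suc t))"
    using F by (auto simp: info_dominated_def)
  have p: "prob_vec n ?p" using h by (rule predictor_info) simp
  show ?thesis
  proof (rule Bochner_Integration.integrable_bound[OF integrable_mult_right[OF mix_dens_obs_size(1)[OF p u], of C]])
    show "(\<lambda>y. mix_dens ?p u y * F (info_snoc (Suc t) h y u)) \<in> borel_measurable (obs_space M u)"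
      using F by (intro borel_measurable_times measurable_mix_dens measurable_snoc_section h u)
        (simp add: info_dominated_def)
    show "AE y in obs_space M u. norm (mix_dens ?p u y * F (info_snoc (Suc t) h y u)) \<le> norm (C * (obs_size u y * mix_dens ?p u y))"
    proof (rule AE_I2)
      fix y assume "y \<in> space (obs_space M u)"
      then have "\<bar>F (info_snoc (Suc t) h y u)\<bar> \<le> C * obs_size u y"
        using C[OF info_snoc_in_info_vecs[OF h u], unfolded snoc_last] by blast
      then have "\<bar>F (info_snoc (Suc t) h y u)\<bar> \<le> \<bar>C * obs_size u y\<bar>" by linarith
      then show "norm (mix_dens ?p u y * F (info_snoc (Suc t) h y u)) \<le> norm (C * (obs_size u y * mix_dens ?p u y))"
        using mult_right_mono[of _ _ "\<bar>mix_dens ?p u y\<bar>"] by (fastforce simp: abs_mult mult_ac)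
    qed
  qed
qed

lemma info_bounded_step_expect:
  assumes F: "info_dominated (Suc t) F" and u: "u \<in> ctrls M"
  shows "info_bounded t (\<lambda>h. step_expect t F h u)"
proof -
  obtain C where C: "\<And>h. h \<in> info_vecs M (Suc t) \<Longrightarrow> \<bar>F h\<bar> \<le> C * obs_size (prev_ctrl M (snd h) (Suc t)) (fst h (Suc t))"
    using F by (auto simp: info_dominated_def)
  have "\<bar>step_expect t F h u\<bar> \<le> \<bar>C\<bar> * size_bound" if h: "h \<in> info_vecs M t" for h
  proof -
    let ?p = "predictor M h (Suc t)"
    have p: "prob_vec n ?p" using h by (rule predictor_info) simp
    have "\<bar>step_expect t F h u\<bar> \<le> (\<integral>y. \<bar>mix_dens ?p u y * F (info_snoc (Suc t) h y u)\<bar> \<partial>obs_space M u)"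
      unfolding step_expect_def by (rule integral_abs_bound)
    also have "\<dots> \<le> (\<integral>y. \<bar>C\<bar> * (obs_size u y * mix_dens ?p u y) \<partial>obs_space M u)"
    proof (rule integral_mono)
      show "integrable (obs_space M u) (\<lambda>y. \<bar>mix_dens ?p u y * F (info_snoc (Suc t) h y u)\<bar>)"
        by (intro integrable_abs step_integrable F h u)
      show "integrable (obs_space M u) (\<lambda>y. \<bar>C\<bar> * (obs_size u y * mix_dens ?p u y))"
        by (intro integrable_mult_right mix_dens_obs_size p u)
      fix y assume "y \<in> space (obs_space M u)"
      then have "\<bar>F (info_snoc (Suc t) h y u)\<bar> \<le> C * obs_size u y"
        using C[OF info_snoc_in_info_vecs[OF h u], unfolded snoc_last] by blast
      also have "\<dots> \<le> \<bar>C\<bar> * obs_size u y" using obs_size_ge_1[of u y] by (intro mult_right_mono) auto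
      finally show "\<bar>mix_dens ?p u y * F (info_snoc (Suc t) h y u)\<bar> \<le> \<bar>C\<bar> * (obs_size u y * mix_dens ?p u y)"
        using mix_dens_pos[OF p u, of y] mult_right_mono[of _ _ "mix_dens ?p u y"]
        by (fastforce simp: abs_mult mult_ac)
    qed
    also have "\<dots> = \<bar>C\<bar> * (\<integral>y. obs_size u y * mix_dens ?p u y \<partial>obs_space M u)" by simp
    also have "\<dots> \<le> \<bar>C\<bar> * size_bound" by (intro mult_left_mono mix_dens_obs_size p u) simp
    finally show ?thesis .
  qed
  moreover have "info_measurable t (\<lambda>h. step_expect t F h u)"
    using F u unfolding info_dominated_def by (intro info_measurable_step_expect) blast+
  ultimately show ?thesis by (rule info_boundedI[rotated])
qed

text \<open>Domination of both functions is what supplies the integrability that monotonicity of the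
  Bochner integral needs.\<close>

lemma step_expect_mono:
  assumes "info_dominated (Suc t) F" "info_dominated (Suc t) G" and h: "h \<in> info_vecs M t" and u: "u \<in> ctrls M"
    and le: "\<And>h. h \<in> info_vecs M (Suc t) \<Longrightarrow> F h \<le> G h"
  shows "step_expect t F h u \<le> step_expect t G h u"
  unfolding step_expect_def
proof (intro integral_mono step_integrable assms(1,2) h u mult_left_mono le)
  fix y assume "y \<in> space (obs_space M u)"
  then show "info_snoc (Suc t) h y u \<in> info_vecs M (Suc t)" by (rule info_snoc_in_info_vecs[OF h u])
  show "0 \<le> mix_dens (predictor M h (Suc t)) u y"
    by (intro less_imp_le mix_dens_pos predictor_info[OF h order_refl] u)
qed

lemma step_expect_cong:
  assumes h: "h \<in> info_vecs M t" and u: "u \<in> ctrls M"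
    and eq: "\<And>h. h \<in> info_vecs M (Suc t) \<Longrightarrow> F h = G h"
  shows "step_expect t F h u = step_expect t G h u"
  unfolding step_expect_def
  using eq[OF info_snoc_in_info_vecs[OF h u]] by (intro Bochner_Integration.integral_cong) auto

text \<open>The predictive density has mass one.\<close>

lemma step_expect_add_const:
  assumes F: "info_dominated (Suc t) F" and h: "h \<in> info_vecs M t" and u: "u \<in> ctrls M"
  shows "step_expect t (\<lambda>h. c + F h) h u = c + step_expect t F h u"
proof -
  let ?p = "predictor M h (Suc t)"
  have p: "prob_vec n ?p" using h by (rule predictor_info) simp
  have "step_expect t (\<lambda>h. c + F h) h u =
    (\<integral>y. c * mix_dens ?p u y + mix_dens ?p u y * F (info_snoc (Suc t) h y u) \<partial>obs_space M u)"
    by (simp add: step_expect_def ring_distribs mult_ac)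
  also have "\<dots> = c + step_expect t F h u"
    using mix_dens_integral[OF p u] step_integrable[OF F h u]
    by (subst Bochner_Integration.integral_add) (auto simp: step_expect_def)
  finally show ?thesis .
qed

text \<open>Rollouts produce Lebesgue integrals with the density as a factor, and
  \<open>step_expect\<close> keeps that form; here it is identified with an expectation under the
  predictive law.\<close>

lemma integral_pred_obs_law:
  assumes h: "h \<in> info_vecs M t" and u: "u \<in> ctrls M" and F: "info_measurable (Suc t) F"
  shows "(\<integral>y. F (info_snoc (Suc t) h y u) \<partial>pred_obs_law M (Suc t) h u) = step_expect t F h u"
proof -
  let ?p = "predictor M h (Suc t)"
  have p: "prob_vec n ?p" using h by (rule predictor_info) simp
  have "pred_obs_law M (Suc t) h u = density (obs_space M u) (\<lambda>y. ennreal (mix_dens ?p u y))"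
    by (simp add: pred_obs_law_def mix_dens_def)
  moreover have "(\<integral>y. F (info_snoc (Suc t) h y u) \<partial>density (obs_space M u) (\<lambda>y. ennreal (mix_dens ?p u y)))
    = (\<integral>y. mix_dens ?p u y *\<^sub>R F (info_snoc (Suc t) h y u) \<partial>obs_space M u)"
    using less_imp_le[OF mix_dens_pos[OF p u]]
    by (intro integral_density measurable_snoc_section measurable_mix_dens assms) auto
  ultimately show ?thesis by (simp add: step_expect_def)
qed

section \<open>Cost of a policy and dynamic-programming value\<close>

primrec policy_cost :: "(nat \<Rightarrow> 'u info \<Rightarrow> 'u) \<Rightarrow> nat \<Rightarrow> nat \<Rightarrow> 'u info \<Rightarrow> real" where
  "policy_cost \<eta> 0 t h = 0"
| "policy_cost \<eta> (Suc m) t h =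
     step_expect t (\<lambda>h'. stage_cost M (Suc t) h' + policy_cost \<eta> m (Suc t) h') h (\<eta> t h)"

text \<open>As in \<open>policy_cost\<close>, \<open>m\<close> counts the stages after time
  \<open>t\<close>, so the horizon is \<open>t + m\<close> and the backward recursion becomes
  primitive recursion on \<open>m\<close>.\<close>

primrec opt_cost :: "nat \<Rightarrow> nat \<Rightarrow> 'u info \<Rightarrow> real" where
  "opt_cost 0 t h = 0"
| "opt_cost (Suc m) t h =
     Min (step_expect t (\<lambda>h'. stage_cost M (Suc t) h' + opt_cost m (Suc t) h') h ` ctrls M)"

lemma ctrls_ne: "ctrls M \<noteq> {}"
  using ctrl0 by auto

lemma info_bounded_zero: "info_bounded t (\<lambda>_. 0)"
  by (auto simp: info_bounded_def info_measurable_def)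

lemma info_bounded_uniform:
  assumes "\<And>u. u \<in> ctrls M \<Longrightarrow> info_bounded t (\<lambda>h. F h u)"
  obtains C where "\<And>u h. u \<in> ctrls M \<Longrightarrow> h \<in> info_vecs M t \<Longrightarrow> \<bar>F h u\<bar> \<le> C"
proof -
  have "\<forall>u\<in>ctrls M. \<exists>C. \<forall>h\<in>info_vecs M t. \<bar>F h u\<bar> \<le> C"
    using assms by (auto simp: info_bounded_def)
  then obtain C where C: "\<And>u h. u \<in> ctrls M \<Longrightarrow> h \<in> info_vecs M t \<Longrightarrow> \<bar>F h u\<bar> \<le> C u"
    unfolding bchoice_iff by auto
  have "\<bar>F h u\<bar> \<le> Max (C ` ctrls M)" if "u \<in> ctrls M" "h \<in> info_vecs M t" for u h
    using C[OF that] Max_ge[of "C ` ctrls M" "C u"] finite_ctrls that(1) by (auto intro: order_trans)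
  then show ?thesis using that by blast
qed

text \<open>A measurable selection among finitely many measurable functions is measurable, and a
  bound common to all controls survives the selection.\<close>

lemma info_bounded_select:
  assumes F: "\<And>u. u \<in> ctrls M \<Longrightarrow> info_bounded t (\<lambda>h. F h u)" and r: "decision_rule M t r"
  shows "info_bounded t (\<lambda>h. F h (r h))"
proof -
  obtain C where C: "\<And>u h. u \<in> ctrls M \<Longrightarrow> h \<in> info_vecs M t \<Longrightarrow> \<bar>F h u\<bar> \<le> C"
    using info_bounded_uniform[of t F] F by blast
  then have "\<bar>F h (r h)\<bar> \<le> C" if "h \<in> info_vecs M t" for h
    using decision_rule_in_ctrls[OF r that] that by blast
  moreover have "info_measurable t (\<lambda>h. F h (r h))"
    unfolding info_measurable_def
  proof
    fix us assume us: "us \<in> {..<t} \<rightarrow>\<^sub>E ctrls M"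
    have g: "(\<lambda>ys. r (ys, us)) \<in> obs_hist M t us \<rightarrow>\<^sub>M count_space (ctrls M)"
      using r us by (simp add: decision_rule_def)
    have f: "(\<lambda>ys. F (ys, us) u) \<in> borel_measurable (obs_hist M t us)" if "u \<in> ctrls M" for u
      using F[OF that] us by (simp add: info_bounded_def info_measurable_def)
    show "(\<lambda>ys. F (ys, us) (r (ys, us))) \<in> borel_measurable (obs_hist M t us)"
      by (rule measurable_compose_countable'[OF f g countable_finite[OF finite_ctrls]])
  qed
  ultimately show ?thesis by (rule info_boundedI[rotated])
qed

lemma info_bounded_Min:
  assumes F: "\<And>u. u \<in> ctrls M \<Longrightarrow> info_bounded t (\<lambda>h. F h u)"
  shows "info_bounded t (\<lambda>h. Min (F h ` ctrls M))"
proof -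
  obtain C where C: "\<And>u h. u \<in> ctrls M \<Longrightarrow> h \<in> info_vecs M t \<Longrightarrow> \<bar>F h u\<bar> \<le> C"
    using info_bounded_uniform[of t F] F by blast
  have "\<bar>Min (F h ` ctrls M)\<bar> \<le> C" if "h \<in> info_vecs M t" for h
  proof -
    have "Min (F h ` ctrls M) \<in> F h ` ctrls M" using finite_ctrls ctrls_ne by (intro Min_in) auto
    then obtain u where "u \<in> ctrls M" "Min (F h ` ctrls M) = F h u" by blast
    then show ?thesis using C[of u h] that by simp
  qed
  moreover have "info_measurable t (\<lambda>h. Min (F h ` ctrls M))"
    using F finite_ctrls ctrls_ne unfolding info_measurable_def info_bounded_def
    by (auto intro!: borel_measurable_Min)
  ultimately show ?thesis by (rule info_boundedI[rotated])
qed

lemma info_bounded_policy_cost: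
  "decision_rules M {t..<t + m} \<eta> \<Longrightarrow> info_bounded t (policy_cost \<eta> m t)"
proof (induction m arbitrary: t)
  case 0
  then show ?case using info_bounded_zero by simp
next
  case (Suc m)
  have r: "decision_rule M t (\<eta> t)" using Suc.prems by (simp add: decision_rules_def)
  have "info_bounded (Suc t) (policy_cost \<eta> m (Suc t))"
    using Suc.prems by (intro Suc.IH) (auto simp: decision_rules_def)
  note dom = info_dominated_stage_add[OF this]
  let ?F = "step_expect t (\<lambda>h'. stage_cost M (Suc t) h' + policy_cost \<eta> m (Suc t) h')"
  have "info_bounded t (\<lambda>h. ?F h (\<eta> t h))"
    by (rule info_bounded_select[where F = ?F, OF _ r]) (rule info_bounded_step_expect[OF dom])
  moreover have "policy_cost \<eta> (Suc m) t = (\<lambda>h. ?F h (\<eta> t h))" by (rule ext) simp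
  ultimately show ?case by (simp only:)
qed

lemma info_bounded_opt_cost: "info_bounded t (opt_cost m t)"
proof (induction m arbitrary: t)
  case 0
  then show ?case using info_bounded_zero by simp
next
  case (Suc m)
  then show ?case
    unfolding opt_cost.simps[abs_def]
    by (intro info_bounded_Min info_bounded_step_expect info_dominated_stage_add)
qed

text \<open>The constant \<open>c\<close> collects the stage costs already incurred, which are constant along the
  rest of the rollout; this avoids splitting the iterated integral of the sum.\<close>

lemma rollout_eq_policy_cost:
  assumes "decision_rules M {t..<t + m} \<eta>" "h \<in> info_vecs M t"
  shows "rollout M \<eta> m t (\<lambda>h'. info_dens M (t + m) h' * (c + (\<Sum>s = Suc t..t + m. stage_cost M s h'))) h
    = info_dens M t h * (c + policy_cost \<eta> m t h)"
  using assms
proof (induction m arbitrary: t h c)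
  case 0
  then show ?case by simp
next
  case (Suc m)
  let ?u = "\<eta> t h"
  let ?G = "\<lambda>h'. stage_cost M (Suc t) h' + policy_cost \<eta> m (Suc t) h'"
  have u: "?u \<in> ctrls M"
    using Suc.prems by (intro decision_rule_in_ctrls) (auto simp: decision_rules_def)
  have dr: "decision_rules M {Suc t..<Suc t + m} \<eta>" using Suc.prems by (auto simp: decision_rules_def)
  have G: "info_dominated (Suc t) ?G" by (intro info_dominated_stage_add info_bounded_policy_cost dr)
  \<comment> \<open>The first stage cost is written as a function of the restricted vector, so that
    it can be frozen at \<open>h1\<close> and moved into the constant.\<close>
  have sum: "(\<Sum>s = Suc t..t + Suc m. stage_cost M s h') =
      stage_cost M (Suc t) (info_restrict (Suc t) h') + (\<Sum>s = Suc (Suc t)..Suc t + m. stage_cost M s h')" for h'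
    by (subst sum.atLeast_Suc_atMost) (simp_all add: stage_cost_restrict)
  have step: "rollout M \<eta> m (Suc t) (\<lambda>h'. info_dens M (t + Suc m) h' * (c + (\<Sum>s = Suc t..t + Suc m. stage_cost M s h'))) h1
      = info_dens M (Suc t) h1 * (c + ?G h1)" if h1: "h1 \<in> info_vecs M (Suc t)" for h1
  proof -
    have "rollout M \<eta> m (Suc t) (\<lambda>h'. info_dens M (t + Suc m) h' * (c + (\<Sum>s = Suc t..t + Suc m. stage_cost M s h'))) h1
      = rollout M \<eta> m (Suc t) (\<lambda>h'. info_dens M (Suc t + m) h' *
          ((c + stage_cost M (Suc t) h1) + (\<Sum>s = Suc (Suc t)..Suc t + m. stage_cost M s h'))) h1"
      unfolding sum
      using rollout_cong_restrict[of "Suc t" "Suc t" M \<eta> m "\<lambda>r h'. info_dens M (Suc t + m) h' *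
          (c + (stage_cost M (Suc t) r + (\<Sum>s = Suc (Suc t)..Suc t + m. stage_cost M s h')))" h1]
      by (simp add: stage_cost_restrict add.assoc)
    also have "\<dots> = info_dens M (Suc t) h1 * ((c + stage_cost M (Suc t) h1) + policy_cost \<eta> m (Suc t) h1)"
      by (rule Suc.IH[OF dr h1])
    finally show ?thesis by (simp add: add.assoc)
  qed
  have "rollout M \<eta> (Suc m) t (\<lambda>h'. info_dens M (t + Suc m) h' * (c + (\<Sum>s = Suc t..t + Suc m. stage_cost M s h'))) h
    = (\<integral>y. info_dens M t h * (mix_dens (predictor M h (Suc t)) ?u y * (c + ?G (info_snoc (Suc t) h y ?u))) \<partial>obs_space M ?u)"
    unfolding rollout.simps
    by (intro Bochner_Integration.integral_cong refl)
      (simp only: step[OF info_snoc_in_info_vecs[OF Suc.prems(2) u]] info_dens_snoc[OF Suc.prems(2)] mult.assoc)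
  also have "\<dots> = info_dens M t h * step_expect t (\<lambda>h. c + ?G h) h ?u"
    by (simp add: step_expect_def)
  also have "\<dots> = info_dens M t h * (c + policy_cost \<eta> (Suc m) t h)"
    by (simp add: step_expect_add_const[OF G Suc.prems(2) u])
  finally show ?case .
qed

text \<open>The density of the conditioning vector is positive, so the quotient in
  \<open>cond_expect\<close> cancels at every \<open>h\<close>.\<close>

lemma remaining_cost_eq_policy_cost:
  assumes "decision_rules M {t..<t + m} \<eta>" "h \<in> info_vecs M t"
  shows "remaining_cost M (t + m) \<eta> (Suc t) h = policy_cost \<eta> m t h"
  using rollout_eq_policy_cost[OF assms, of 0] info_dens_info_pos[OF assms(2)]
  by (simp add: remaining_cost_def cond_expect_def)

lemma opt_cost_le_policy_cost:
  "decision_rules M {t..<t + m} \<eta> \<Longrightarrow> h \<in> info_vecs M t \<Longrightarrow> opt_cost m t h \<le> policy_cost \<eta> m t h"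
proof (induction m arbitrary: t h)
  case (Suc m)
  have u: "\<eta> t h \<in> ctrls M"
    using Suc.prems by (intro decision_rule_in_ctrls) (auto simp: decision_rules_def)
  have dr: "decision_rules M {Suc t..<Suc t + m} \<eta>" using Suc.prems by (auto simp: decision_rules_def)
  have "opt_cost (Suc m) t h \<le> step_expect t (\<lambda>h'. stage_cost M (Suc t) h' + opt_cost m (Suc t) h') h (\<eta> t h)"
    using finite_ctrls u by simp
  also have "\<dots> \<le> policy_cost \<eta> (Suc m) t h"
    unfolding policy_cost.simps
    by (intro step_expect_mono info_dominated_stage_add info_bounded_opt_cost info_bounded_policy_cost
        add_left_mono Suc.IH dr u Suc.prems)
  finally show ?case .
qed simp

text \<open>The controls are enumerated and the minimiser of least index is taken: being a minimiser
  is a finite conjunction of comparisons of measurable functions, and the least index satisfying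
  measurable predicates is measurable.\<close>

lemma measurable_argmin:
  assumes F: "\<And>u. u \<in> ctrls M \<Longrightarrow> info_measurable t (\<lambda>h. F h u)"
  shows "\<exists>r. decision_rule M t r \<and> (\<forall>h. F h (r h) = Min (F h ` ctrls M))"
proof -
  obtain e where e: "bij_betw e {0..<card (ctrls M)} (ctrls M)"
    using ex_bij_betw_nat_finite[OF finite_ctrls] by blast
  let ?N = "card (ctrls M)"
  define opt where "opt h i \<longleftrightarrow> i < ?N \<and> (\<forall>u\<in>ctrls M. F h (e i) \<le> F h u)" for h i
  have e_in: "i < ?N \<Longrightarrow> e i \<in> ctrls M" for i using e by (auto simp: bij_betw_def)
  define r where "r h = e (LEAST i. opt h i)" for h
  have ex: "\<exists>i. opt h i" for h
  proof -
    have "Min (F h ` ctrls M) \<in> F h ` ctrls M" using finite_ctrls ctrls_ne by (intro Min_in) auto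
    then obtain u where u: "u \<in> ctrls M" "F h u = Min (F h ` ctrls M)" by force
    then have "u \<in> e ` {0..<?N}" using e by (simp add: bij_betw_def)
    then obtain i where "i < ?N" "e i = u" by auto
    then show ?thesis using u finite_ctrls by (intro exI[of _ i]) (auto simp: opt_def)
  qed
  have opt_r: "opt h (LEAST i. opt h i)" for h using LeastI_ex[OF ex] .
  have "F h (r h) = Min (F h ` ctrls M)" for h
    using opt_r[of h] e_in finite_ctrls by (intro Min_eqI[symmetric]) (auto simp: opt_def r_def)
  moreover have "decision_rule M t r" unfolding decision_rule_def
  proof
    fix us assume us: "us \<in> {..<t} \<rightarrow>\<^sub>E ctrls M"
    let ?O = "obs_hist M t us"
    have F': "(\<lambda>ys. F (ys, us) u) \<in> borel_measurable ?O" if "u \<in> ctrls M" for u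
      using F[OF that] us by (simp add: info_measurable_def)
    have le: "Measurable.pred ?O (\<lambda>ys. F (ys, us) u \<le> F (ys, us) v)" if "u \<in> ctrls M" "v \<in> ctrls M" for u v
      unfolding pred_def using F'[OF that(1)] F'[OF that(2)] by (rule borel_measurable_le)
    have m: "Measurable.pred ?O (\<lambda>ys. opt (ys, us) i)" for i
    proof (cases "i < ?N")
      case True
      then show ?thesis unfolding opt_def using e_in[OF True] finite_ctrls
        by (intro pred_intros_logic pred_intros_finite le) auto
    qed (simp add: opt_def)
    have L: "(\<lambda>ys. LEAST i. opt (ys, us) i) \<in> ?O \<rightarrow>\<^sub>M count_space UNIV"
      by (intro measurable_Least m)
    \<comment> \<open>The codomain is cut down to valid indices, which \<open>e\<close> maps into
      the control set.\<close>
    have "(\<lambda>ys. LEAST i. opt (ys, us) i) \<in> ?O \<rightarrow>\<^sub>M count_space {0..<?N}"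
      using opt_r by (intro measurable_count_space_extend[OF _ _ L]) (auto simp: opt_def)
    from measurable_compose[OF this, of e "count_space (ctrls M)"]
    show "(\<lambda>ys. r (ys, us)) \<in> ?O \<rightarrow>\<^sub>M count_space (ctrls M)"
      using e_in by (simp add: r_def)
  qed
  ultimately show ?thesis by blast
qed

text \<open>Each rule minimises against \<open>opt_cost\<close> of the later stages and not against
  the later rules, so the rules are chosen independently of one another. The induction then shows
  that together they attain the value, with one policy serving all \<open>h\<close>.\<close>

lemma optimal_policy_exists:
  "\<exists>\<eta>. decision_rules M {t..<t + m} \<eta> \<and> (\<forall>h\<in>info_vecs M t. policy_cost \<eta> m t h = opt_cost m t h)"
proof -
  let ?F = "\<lambda>k s. step_expect s (\<lambda>h'. stage_cost M (Suc s) h' + opt_cost k (Suc s) h')"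
  \<comment> \<open>At time \<open>s\<close>, \<open>t + m - Suc s\<close> stages are left after the
    next one. Truncated subtraction keeps this meaningful for every \<open>s\<close>, so plain
    choice applies.\<close>
  have "\<forall>s. \<exists>r. decision_rule M s r \<and> (\<forall>h. ?F (t + m - Suc s) s h (r h) = Min (?F (t + m - Suc s) s h ` ctrls M))"
  proof (intro allI measurable_argmin)
    fix s u assume "u \<in> ctrls M"
    then have "info_bounded s (\<lambda>h. ?F (t + m - Suc s) s h u)"
      by (intro info_bounded_step_expect info_dominated_stage_add info_bounded_opt_cost)
    then show "info_measurable s (\<lambda>h. ?F (t + m - Suc s) s h u)" by (simp add: info_bounded_def)
  qed
  then obtain \<eta> where \<eta>: "\<And>s. decision_rule M s (\<eta> s)"
    "\<And>s h. ?F (t + m - Suc s) s h (\<eta> s h) = Min (?F (t + m - Suc s) s h ` ctrls M)"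
    unfolding choice_iff by blast
  have "policy_cost \<eta> k s h = opt_cost k s h" if "s + k = t + m" "h \<in> info_vecs M s" for k s h
    using that
  proof (induction k arbitrary: s h)
    case (Suc k)
    have k: "t + m - Suc s = k" using Suc.prems(1) by simp
    have "policy_cost \<eta> (Suc k) s h = ?F k s h (\<eta> s h)"
      unfolding policy_cost.simps
      using Suc.prems Suc.IH[of "Suc s"] by (intro step_expect_cong decision_rule_in_ctrls[OF \<eta>(1)]) auto
    also have "\<dots> = opt_cost (Suc k) s h" using \<eta>(2)[of s h] by (simp add: k)
    finally show ?case .
  qed simp
  then show ?thesis using \<eta>(1) by (intro exI[of _ \<eta>]) (auto simp: decision_rules_def)
qed

section \<open>The cost-to-go and its recursion\<close>

lemma cost_to_go_eq_opt_cost: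
  assumes h: "h \<in> info_vecs M t"
  shows "cost_to_go M (t + m) (Suc t) h = opt_cost m t h"
  unfolding cost_to_go_def
proof (rule Least_equality)
  obtain \<eta> where "decision_rules M {t..<t + m} \<eta>" "policy_cost \<eta> m t h = opt_cost m t h"
    using optimal_policy_exists h by blast
  then show "\<exists>\<eta>. decision_rules M {Suc t - 1..<t + m} \<eta> \<and> opt_cost m t h = remaining_cost M (t + m) \<eta> (Suc t) h"
    using remaining_cost_eq_policy_cost[of t m \<eta> h] h by auto
next
  fix c assume "\<exists>\<eta>. decision_rules M {Suc t - 1..<t + m} \<eta> \<and> c = remaining_cost M (t + m) \<eta> (Suc t) h"
  then obtain \<eta> where "decision_rules M {t..<t + m} \<eta>" "c = remaining_cost M (t + m) \<eta> (Suc t) h"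
    by auto
  then show "opt_cost m t h \<le> c"
    using remaining_cost_eq_policy_cost[OF _ h] opt_cost_le_policy_cost[OF _ h] by simp
qed

lemma cost_to_go_Bellman:
  assumes h: "h \<in> info_vecs M t" and tL: "Suc t < L"
  shows "cost_to_go M L (Suc t) h =
    Min ((\<lambda>u. \<integral>y. stage_cost M (Suc t) (info_snoc (Suc t) h y u)
        + cost_to_go M L (Suc (Suc t)) (info_snoc (Suc t) h y u) \<partial>pred_obs_law M (Suc t) h u) ` ctrls M)"
proof -
  define m where "m = L - Suc t"
  \<comment> \<open>The same horizon seen from two times: \<open>Suc m\<close> stages after
    \<open>t\<close>, and \<open>m\<close> stages after \<open>Suc t\<close>.\<close>
  have L: "L = t + Suc m" "L = Suc t + m" using tL by (auto simp: m_def)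
  let ?F = "\<lambda>h'. stage_cost M (Suc t) h' + opt_cost m (Suc t) h'"
  have "(\<integral>y. stage_cost M (Suc t) (info_snoc (Suc t) h y u)
        + cost_to_go M L (Suc (Suc t)) (info_snoc (Suc t) h y u) \<partial>pred_obs_law M (Suc t) h u) = step_expect t ?F h u"
    if u: "u \<in> ctrls M" for u
  proof -
    have "(\<integral>y. stage_cost M (Suc t) (info_snoc (Suc t) h y u)
        + cost_to_go M L (Suc (Suc t)) (info_snoc (Suc t) h y u) \<partial>pred_obs_law M (Suc t) h u)
      = (\<integral>y. ?F (info_snoc (Suc t) h y u) \<partial>pred_obs_law M (Suc t) h u)"
    proof (rule Bochner_Integration.integral_cong[OF refl])
      fix y assume "y \<in> space (pred_obs_law M (Suc t) h u)"
      then have "info_snoc (Suc t) h y u \<in> info_vecs M (Suc t)"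
        by (intro info_snoc_in_info_vecs h u) (simp add: pred_obs_law_def)
      then show "stage_cost M (Suc t) (info_snoc (Suc t) h y u)
        + cost_to_go M L (Suc (Suc t)) (info_snoc (Suc t) h y u) = ?F (info_snoc (Suc t) h y u)"
        unfolding L(2) by (simp only: cost_to_go_eq_opt_cost)
    qed
    also have "\<dots> = step_expect t ?F h u"
      using info_dominated_stage_add[OF info_bounded_opt_cost]
      by (intro integral_pred_obs_law h u) (simp add: info_dominated_def)
    finally show ?thesis .
  qed
  then show ?thesis
    using cost_to_go_eq_opt_cost[OF h, of "Suc m", folded L(1)] by (simp cong: image_cong_simp)
qed

text \<open>With one stage left the continuation value \<open>opt_cost 0\<close> is zero.\<close>

lemma cost_to_go_last:
  assumes h: "h \<in> info_vecs M t"
  shows "cost_to_go M (Suc t) (Suc t) h =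
    Min ((\<lambda>u. \<integral>y. stage_cost M (Suc t) (info_snoc (Suc t) h y u) \<partial>pred_obs_law M (Suc t) h u) ` ctrls M)"
  using cost_to_go_eq_opt_cost[OF h, of 1] integral_pred_obs_law[OF h _ info_measurable_stage_cost]
  by (simp cong: image_cong_simp)

end

theorem theorem3:
  fixes M :: "'u hmm" and L :: nat
  assumes "valid_hmm M" and "1 \<le> L"
  shows "(\<forall>k\<in>{1..L - 1}. \<forall>h\<in>info_vecs M (k - 1).
            cost_to_go M L k h =
              Min ((\<lambda>u. \<integral>y. stage_cost M k (info_snoc k h y u)
                             + cost_to_go M L (k + 1) (info_snoc k h y u) \<partial>pred_obs_law M k h u)
                   ` ctrls M))
       \<and> (\<forall>h\<in>info_vecs M (L - 1).
            cost_to_go M L L h =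
              Min ((\<lambda>u. \<integral>y. stage_cost M L (info_snoc L h y u) \<partial>pred_obs_law M L h u)
                   ` ctrls M))"
proof -
  interpret hmm_model M using assms(1) by unfold_locales
  have "cost_to_go M L k h =
      Min ((\<lambda>u. \<integral>y. stage_cost M k (info_snoc k h y u)
           + cost_to_go M L (k + 1) (info_snoc k h y u) \<partial>pred_obs_law M k h u) ` ctrls M)"
    if "k \<in> {1..L - 1}" "h \<in> info_vecs M (k - 1)" for k h
  proof -
    \<comment> \<open>For \<open>L = 1\<close> the range of \<open>k\<close> is empty; in general
      \<open>k \<ge> 1\<close> makes the truncated \<open>k - 1\<close> a true predecessor.\<close>
    have "k < L" "Suc (k - 1) = k" using that(1) assms(2) by auto
    then show ?thesis using cost_to_go_Bellman[OF that(2), of L] by simp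
  qed
  moreover have "cost_to_go M L L h =
      Min ((\<lambda>u. \<integral>y. stage_cost M L (info_snoc L h y u) \<partial>pred_obs_law M L h u) ` ctrls M)"
    if "h \<in> info_vecs M (L - 1)" for h
    using cost_to_go_last[OF that] assms(2) by simp
  ultimately show ?thesis by blast
qed

end
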